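(* Let $\phi_\ell$ be the characteristic function of an infinitely divisible probability distribution on $\mathbb{R}$. For any $t\in\mathbb{T}$, $t>0$, assume that the probability density $f_t$ corresponding to the characteristic function $(\phi_\ell)^t$ exists. For $n\in\mathbb{N}$, let $\overline\ell^{(n)}$ be the process generated on $(\Omega,(\mathcal{A}_t,t\ge0),\mathbb{P})$ from the densities $f_t$ by the bridge sampling algorithm described in the context. If $\int_{\mathbb{R}}|x|^pf_1(x)\,dx<\infty$ for some $p\in[1,\infty)$, then for every $t\in\mathbb{T}$ $$\lim_{n\to\infty}\mathbb{E}\big(|\overline\ell^{(n)}(t)-\ell(t)|^p\big)=0,$$ where $\ell$ is a Lévy process with characteristic function $\phi_\ell$ on $(\Omega,(\mathcal{A}_t,t\ge0),\mathbb{P})$.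
   Context: $\mathbb{T}=[0,T]$ with $T>0$; $(\Omega,(\mathcal{A}_t,t\ge0),\mathbb{P})$ is a filtered probability space satisfying the usual conditions. A Lévy process $\ell$ "with characteristic function $\phi_\ell$" satisfies $\mathbb{E}[\exp(iu\ell(t))]=(\phi_\ell(u))^t$. Bridge sampling algorithm. Generate $\mathcal{X}_{0,1}$ with density $f_T$, set $\mathcal{X}_{0,0}:=0$, $\Delta_0:=T$. For $i=1,\dots,n$: let $\Delta_i:=T/2^i$; for $j=0,2,\dots,2^i$ set $\mathcal{X}_{i,j}:=\mathcal{X}_{i-1,j/2}$; for $j=1,3,\dots,2^i-1$ generate the increment $X$ over $[(j-1)T/2^i,jT/2^i]$ conditionally on the values already generated, i.e. sample $X$ with the conditional (Lévy bridge) density $$x\mapsto\frac{f_{\Delta_i}(x)\,f_{\Delta_i}(\mathcal{X}_{i,j+1}-\mathcal{X}_{i,j-1}-x)}{f_{\Delta_{i-1}}(\mathcal{X}_{i,j+1}-\mathcal{X}_{i,j-1})}$$ (independently for different $j$ given the values of the previous level) and set $\mathcal{X}_{i,j}:=X+\mathcal{X}_{i,j-1}$. Define $$\overline\ell^{(n)}(t):=\mathcal{X}_{n,2^n}\mathbf{1}_{\{T\}}(t)+\sum_{j=1}^{2^n}\mathcal{X}_{n,j-1}\mathbf{1}_{[(j-1)T/2^n,\,jT/2^n)}(t).$$ The processes $\overline\ell^{(n)}$, $n\in\mathbb{N}$, are obtained by successively refining the same family $(\mathcal{X}_{i,j})$. *)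

theory Defs
  imports "HOL-Probability.Probability"
begin

locale usual_filtered_prob_space = prob_space M + complete_measure M
  for M :: "'a measure" +
  fixes F :: "real \<Rightarrow> 'a measure"  \<comment> \<open>only the values at times \<open>t \<ge> 0\<close> matter\<close>
  assumes subalg: "0 \<le> t \<Longrightarrow> subalgebra M (F t)"
    and mono: "0 \<le> s \<Longrightarrow> s \<le> t \<Longrightarrow> sets (F s) \<subseteq> sets (F t)"
    and null: "null_sets M \<subseteq> sets (F 0)"
    and right_cont: "0 \<le> s \<Longrightarrow> (\<Inter>t\<in>{s<..}. sets (F t)) = sets (F s)"

text \<open>Here \<open>((\<star>) \<nu> ^^ n) (return borel 0)\<close> is the n-fold convolution power of \<open>\<nu>\<close>.\<close>

definition infinitely_divisible :: "real measure \<Rightarrow> bool" where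
  "infinitely_divisible \<mu> \<longleftrightarrow> real_distribution \<mu> \<and>
     (\<forall>n::nat. n \<ge> 1 \<longrightarrow>
        (\<exists>\<nu>. real_distribution \<nu> \<and> \<mu> = ((\<star>) \<nu> ^^ n) (return borel 0)))"

text \<open>The power \<open>\<phi>\<^sup>t\<close> of an infinitely divisible characteristic function is not the pointwise
  principal power: it is \<open>exp (t * \<psi>)\<close> for the unique continuous logarithm \<open>\<psi>\<close> of \<open>\<phi>\<close> with
  \<open>\<psi> 0 = 0\<close> (which exists since such a \<open>\<phi>\<close> has no zeros).\<close>

definition is_distinguished_log :: "(real \<Rightarrow> complex) \<Rightarrow> (real \<Rightarrow> complex) \<Rightarrow> bool" where
  "is_distinguished_log \<phi> \<psi> \<longleftrightarrow>
     continuous_on UNIV \<psi> \<and> \<psi> 0 = 0 \<and> (\<forall>u. exp (\<psi> u) = \<phi> u)"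

definition distinguished_log :: "(real \<Rightarrow> complex) \<Rightarrow> real \<Rightarrow> complex" where
  "distinguished_log \<phi> = (THE \<psi>. is_distinguished_log \<phi> \<psi>)"

definition char_power :: "(real \<Rightarrow> complex) \<Rightarrow> real \<Rightarrow> real \<Rightarrow> complex" where
  "char_power \<phi> t u = exp (of_real t * distinguished_log \<phi> u)"

lemma is_distinguished_log_unique:
  assumes "is_distinguished_log \<phi> \<psi>" "is_distinguished_log \<phi> \<eta>"
  shows "\<psi> = \<eta>"
proof
  fix u
  let ?d = "\<lambda>u. \<psi> u - \<eta> u"
  have cont: "continuous_on UNIV ?d"
    using assms by (auto simp: is_distinguished_log_def intro!: continuous_intros)
  have ex: "exp (?d v) = 1" for v
    using assms by (auto simp: is_distinguished_log_def exp_diff) (metis exp_not_eq_zero)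
  have "?d constant_on UNIV"
  proof (rule continuous_discrete_range_constant[OF connected_UNIV cont])
    fix x :: real
    have "2 * pi \<le> norm (?d y - ?d x)" if "?d y \<noteq> ?d x" for y
    proof -
      have "exp (?d y - ?d x) = 1" using ex[of x] ex[of y] by (simp add: exp_diff)
      then obtain n :: int where n: "Re (?d y - ?d x) = 0" "Im (?d y - ?d x) = of_int (2 * n) * pi"
        unfolding exp_eq_1 by blast
      with that have "n \<noteq> 0" by (auto simp: complex_eq_iff)
      then have "1 \<le> \<bar>real_of_int n\<bar>" by linarith
      then have "2 * pi \<le> \<bar>Im (?d y - ?d x)\<bar>" unfolding n(2) by (simp add: abs_mult)
      also have "\<dots> \<le> norm (?d y - ?d x)" by (rule abs_Im_le_cmod)
      finally show ?thesis .
    qed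
    then show "\<exists>e>0. \<forall>y. y \<in> UNIV \<and> ?d y \<noteq> ?d x \<longrightarrow> e \<le> norm (?d y - ?d x)"
      by (intro exI[of _ "2 * pi"]) auto
  qed
  then obtain c where c: "\<And>v. ?d v = c" unfolding constant_on_def by auto
  from c[of 0] have "c = 0" using assms by (simp add: is_distinguished_log_def)
  with c[of u] show "\<psi> u = \<eta> u" by simp
qed

lemma distinguished_log_eqI: "is_distinguished_log \<phi> \<psi> \<Longrightarrow> distinguished_log \<phi> = \<psi>"
  unfolding distinguished_log_def
  by (rule the_equality) (auto intro: is_distinguished_log_unique)

definition prob_density_of_char :: "(real \<Rightarrow> real) \<Rightarrow> (real \<Rightarrow> complex) \<Rightarrow> bool" where
  "prob_density_of_char g \<eta> \<longleftrightarrow>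
     g \<in> borel_measurable borel \<and> (\<forall>x. 0 \<le> g x) \<and>
     prob_space (density lborel (\<lambda>x. ennreal (g x))) \<and>
     char (density lborel (\<lambda>x. ennreal (g x))) = \<eta>"

definition level_algebra :: "'a measure \<Rightarrow> (nat \<Rightarrow> nat \<Rightarrow> 'a \<Rightarrow> real) \<Rightarrow> nat \<Rightarrow> 'a measure" where
  "level_algebra M X i =
     sigma (space M) {X i j -` B \<inter> space M | j B. j \<le> 2 ^ i \<and> B \<in> sets borel}"

definition bridge_density :: "(real \<Rightarrow> real \<Rightarrow> real) \<Rightarrow> real \<Rightarrow> nat \<Rightarrow> real \<Rightarrow> real \<Rightarrow> real" where
  "bridge_density f T i y x =
     f (T / 2 ^ i) x * f (T / 2 ^ i) (y - x) / f (T / 2 ^ (i - 1)) y"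

text \<open>The last clause says that, given the values of level \<open>i - 1\<close> (which include those of all
  earlier levels), the new increments of level \<open>i\<close> are conditionally independent with the bridge
  densities: their joint conditional law is the product of these densities. Since \<open>j\<close> is odd, the
  endpoint values \<open>X i (j - 1)\<close> and \<open>X i (j + 1)\<close> are copied from level \<open>i - 1\<close>. The denominator of
  the bridge density almost surely does not vanish there.\<close>

definition bridge_sampling ::
    "'a measure \<Rightarrow> real \<Rightarrow> (real \<Rightarrow> real \<Rightarrow> real) \<Rightarrow> (nat \<Rightarrow> nat \<Rightarrow> 'a \<Rightarrow> real) \<Rightarrow> bool" where
  "bridge_sampling M T f X \<longleftrightarrow>
     (\<forall>i. \<forall>j\<le>2 ^ i. X i j \<in> borel_measurable M) \<and>
     (\<forall>\<omega>\<in>space M. X 0 0 \<omega> = 0) \<and>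
     distributed M lborel (X 0 1) (\<lambda>x. ennreal (f T x)) \<and>
     (\<forall>i\<ge>1. \<forall>j\<le>2 ^ i. even j \<longrightarrow> (\<forall>\<omega>\<in>space M. X i j \<omega> = X (i - 1) (j div 2) \<omega>)) \<and>
     (\<forall>i\<ge>1. \<forall>B. (\<forall>j. B j \<in> sets borel) \<longrightarrow>
        (AE \<omega> in M.
           real_cond_exp M (level_algebra M X (i - 1))
             (indicator {\<omega>\<in>space M. \<forall>j<2 ^ i. odd j \<longrightarrow> X i j \<omega> - X i (j - 1) \<omega> \<in> B j}) \<omega> =
           (\<Prod>j\<in>{j. j < 2 ^ i \<and> odd j}.
              LINT x:B j|lborel. bridge_density f T i (X i (j + 1) \<omega> - X i (j - 1) \<omega>) x)))"

definition bridge_process ::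
    "real \<Rightarrow> (nat \<Rightarrow> nat \<Rightarrow> 'a \<Rightarrow> real) \<Rightarrow> nat \<Rightarrow> real \<Rightarrow> 'a \<Rightarrow> real" where
  "bridge_process T X n t \<omega> =
     X n (2 ^ n) \<omega> * indicator {T} t +
     (\<Sum>j = 1..2 ^ n. X n (j - 1) \<omega> *
        indicator {real (j - 1) * T / 2 ^ n ..< real j * T / 2 ^ n} t)"

definition levy_process :: "'a measure \<Rightarrow> real \<Rightarrow> (real \<Rightarrow> 'a \<Rightarrow> real) \<Rightarrow> bool" where
  "levy_process M T L \<longleftrightarrow>
     (\<forall>t\<in>{0..T}. L t \<in> borel_measurable M) \<and>
     (AE \<omega> in M. L 0 \<omega> = 0) \<and>
     (\<forall>(n::nat) s. 0 \<le> s 0 \<and> (\<forall>i<n. s i \<le> s (Suc i)) \<and> s n \<le> T \<longrightarrow>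
        prob_space.indep_vars M (\<lambda>_. borel) (\<lambda>i \<omega>. L (s (Suc i)) \<omega> - L (s i) \<omega>) {..<n}) \<and>
     (\<forall>s h. 0 \<le> s \<and> 0 \<le> h \<and> s + h \<le> T \<longrightarrow>
        distr M borel (\<lambda>\<omega>. L (s + h) \<omega> - L s \<omega>) = distr M borel (\<lambda>\<omega>. L h \<omega> - L 0 \<omega>)) \<and>
     (\<forall>t\<in>{0..T}. \<forall>\<epsilon>>0.
        ((\<lambda>s. measure M {\<omega>\<in>space M. \<bar>L s \<omega> - L t \<omega>\<bar> > \<epsilon>}) \<longlongrightarrow> 0) (at t within {0..T}))"

text \<open>Relation of a process to the filtration: adaptedness, and independence of future increments
  from the past, with time restricted to a set \<open>S\<close>.\<close>

definition levy_filtration ::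
    "'a measure \<Rightarrow> (real \<Rightarrow> 'a measure) \<Rightarrow> real set \<Rightarrow> (real \<Rightarrow> 'a \<Rightarrow> real) \<Rightarrow> bool" where
  "levy_filtration M F S L \<longleftrightarrow>
     (\<forall>t\<in>S. L t \<in> borel_measurable (F t)) \<and>
     (\<forall>s\<in>S. \<forall>t\<in>S. s \<le> t \<longrightarrow>
        prob_space.indep_set M (sets (F s))
          {(\<lambda>\<omega>. L t \<omega> - L s \<omega>) -` B \<inter> space M | B. B \<in> sets borel})"

definition dyadic_grid :: "real \<Rightarrow> nat \<Rightarrow> real set" where
  "dyadic_grid T n = {real j * T / 2 ^ n | j. j \<le> 2 ^ n}"

end

theory Submission
  imports Defs
begin

text \<open>Conditioning on the coarser level, the joint law of a coarse increment and its first half is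
  that of \<open>(U + V, U)\<close> for independent \<open>U\<close>, \<open>V\<close> with the fine density, because the density over time
  \<open>2h\<close> is the convolution square of the one over time \<open>h\<close>. By induction the increments of level \<open>n\<close>
  are therefore independent with density \<open>f (T / 2^n)\<close>. The terminal value has a finite \<open>p\<close>-th moment,
  and centring plus Jensen's inequality transfers uniform integrability from it to all grid
  increments, whose \<open>p\<close>-th moments thus tend to 0 uniformly with the time step. Hence the bridge
  processes are Cauchy in \<open>L\<^sup>p\<close> at each time; their limit is the Levy process, because
  characteristic functions and independence pass to the limit.\<close>

text \<open>No Levy process is given beforehand: the L^p limit itself is the witness, so convergence
  has to come from a Cauchy estimate that speaks of grid increments only. The obstacle is that p is
  any real number at least 1, so neither a variance formula nor a scaling rule yields moments over
  short times. What is known is that an increment A over a short time is close to 0 in probability,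
  uniformly in level and position. To reach L^p one needs a single integrable function whose
  integral over the event that A is large bounds that of |A|^p, for all increments at once. The
  terminal value supplies it: it equals A + B with B independent of A. As B may have a nonzero mean,
  Jensen's inequality applies only after subtracting E B, and this shift stays bounded because each
  of the 2^n increments carries the same share of the terminal mean. To identify the limit, L^1
  convergence is enough: complex exponentials and truncated distance functions are Lipschitz.
  Moments are integrals with values in [0,\<infinity>], so that finiteness can be a
  conclusion.\<close>

section \<open>Powers of absolute values, convolutions, and tails at small times\<close>

lemma abs_add_powr_le:
  fixes a b p :: real
  assumes "0 \<le> p"
  shows "\<bar>a + b\<bar> powr p \<le> 2 powr p * (\<bar>a\<bar> powr p + \<bar>b\<bar> powr p)"
proof -
  have "\<bar>a + b\<bar> powr p \<le> (2 * max \<bar>a\<bar> \<bar>b\<bar>) powr p"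
    using assms by (intro powr_mono2) auto
  also have "\<dots> = 2 powr p * max \<bar>a\<bar> \<bar>b\<bar> powr p"
    by (simp add: powr_mult)
  also have "max \<bar>a\<bar> \<bar>b\<bar> powr p \<le> \<bar>a\<bar> powr p + \<bar>b\<bar> powr p"
    by (auto simp: max_def)
  finally show ?thesis by simp
qed

lemma convex_on_abs_powr:
  fixes p :: real
  assumes "1 \<le> p"
  shows "convex_on UNIV (\<lambda>x::real. \<bar>x\<bar> powr p)"
proof -
  have *: "(t * x + (1 - t) * y) powr p \<le> t * x powr p + (1 - t) * y powr p"
    if "0 \<le> x" "0 \<le> y" "0 \<le> t" "t \<le> 1" for x y t :: real
  proof -
    \<comment> \<open>If x or y is 0, convexity reduces to this scaling bound, which holds since
      \<open>s powr p \<le> s\<close> for s in [0,1]; for positive x and y the convexity on the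
      half-line applies.\<close>
    have 1: "(s * z) powr p \<le> s * z powr p" if "0 \<le> s" "s \<le> 1" "0 \<le> z" for s z :: real
      using powr_mono'[of 1 p s] that assms by (auto simp: powr_mult intro!: mult_right_mono)
    show ?thesis
    proof (cases "x = 0 \<or> y = 0")
      case True
      then show ?thesis using 1[of t x] 1[of "1 - t" y] that by auto
    next
      case False
      then show ?thesis
        using convex_onD[OF powr_convex[OF assms], of "1 - t" x y] that by auto
    qed
  qed
  show ?thesis
  proof (rule convex_onI)
    fix t x y :: real assume t: "0 < t" "t < 1"
    have "\<bar>(1 - t) * x + t * y\<bar> powr p \<le> ((1 - t) * \<bar>x\<bar> + t * \<bar>y\<bar>) powr p"
      using t assms by (intro powr_mono2 order_trans[OF abs_triangle_ineq]) (auto simp: abs_mult)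
    also have "\<dots> \<le> (1 - t) * \<bar>x\<bar> powr p + t * \<bar>y\<bar> powr p"
      using *[of "\<bar>x\<bar>" "\<bar>y\<bar>" "1 - t"] t by simp
    finally show "\<bar>(1 - t) *\<^sub>R x + t *\<^sub>R y\<bar> powr p \<le> (1 - t) * \<bar>x\<bar> powr p + t * \<bar>y\<bar> powr p"
      by simp
  qed simp
qed

lemma real_distribution_convolution:
  assumes "real_distribution \<mu>" "real_distribution \<nu>"
  shows "real_distribution (\<mu> \<star> \<nu>)"
proof -
  interpret \<mu>: real_distribution \<mu> by fact
  interpret \<nu>: real_distribution \<nu> by fact
  interpret pair_prob_space \<mu> \<nu> ..
  show ?thesis
    unfolding convolution_def by (intro real_distribution_distr) measurable
qed

lemma char_convolution:
  assumes "real_distribution \<mu>" "real_distribution \<nu>"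
  shows "char (\<mu> \<star> \<nu>) u = char \<mu> u * char \<nu> u"
proof -
  interpret \<mu>: real_distribution \<mu> by fact
  interpret \<nu>: real_distribution \<nu> by fact
  interpret pair_prob_space \<mu> \<nu> ..
  have int: "integrable (\<mu> \<Otimes>\<^sub>M \<nu>) (\<lambda>(x, y). iexp (u * (x + y)))"
    by (intro P.integrable_const_bound[of _ 1]) (auto simp: case_prod_beta)
  have "char (\<mu> \<star> \<nu>) u = (CLINT z|\<mu> \<Otimes>\<^sub>M \<nu>. iexp (u * (fst z + snd z)))"
    unfolding char_def convolution_def
    by (subst integral_distr) (auto simp: case_prod_beta)
  also have "\<dots> = (CLINT x|\<mu>. CLINT y|\<nu>. iexp (u * (x + y)))"
    using integral_fst'[OF int] by (simp add: case_prod_unfold)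
  also have "\<dots> = (CLINT x|\<mu>. iexp (u * x) * (CLINT y|\<nu>. iexp (u * y)))"
    by (subst integral_mult_right_zero[symmetric])
       (simp add: exp_add[symmetric] ring_distribs)
  also have "\<dots> = char \<mu> u * char \<nu> u"
    unfolding char_def by simp
  finally show ?thesis .
qed

lemma moment_convolution:
  fixes p :: real
  assumes "real_distribution \<mu>" "real_distribution \<nu>" and p: "0 \<le> p"
    and "(\<integral>\<^sup>+x. ennreal (\<bar>x\<bar> powr p) \<partial>\<mu>) < \<infinity>" "(\<integral>\<^sup>+x. ennreal (\<bar>x\<bar> powr p) \<partial>\<nu>) < \<infinity>"
  shows "(\<integral>\<^sup>+x. ennreal (\<bar>x\<bar> powr p) \<partial>(\<mu> \<star> \<nu>)) < \<infinity>"
proof -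
  interpret \<mu>: real_distribution \<mu> by fact
  interpret \<nu>: real_distribution \<nu> by fact
  have "(\<integral>\<^sup>+x. ennreal (\<bar>x\<bar> powr p) \<partial>(\<mu> \<star> \<nu>)) =
      (\<integral>\<^sup>+x. \<integral>\<^sup>+y. ennreal (\<bar>x + y\<bar> powr p) \<partial>\<nu> \<partial>\<mu>)"
    by (intro nn_integral_convolution) (auto simp: \<mu>.finite_measure_axioms \<nu>.finite_measure_axioms)
  also have "\<dots> \<le> (\<integral>\<^sup>+x. \<integral>\<^sup>+y. ennreal (2 powr p) * (ennreal (\<bar>x\<bar> powr p) + ennreal (\<bar>y\<bar> powr p)) \<partial>\<nu> \<partial>\<mu>)"
    using abs_add_powr_le[OF p]
    by (intro nn_integral_mono) (simp flip: ennreal_plus ennreal_mult)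
  also have "\<dots> = ennreal (2 powr p) * ((\<integral>\<^sup>+x. ennreal (\<bar>x\<bar> powr p) \<partial>\<mu>) + (\<integral>\<^sup>+x. ennreal (\<bar>x\<bar> powr p) \<partial>\<nu>))"
    by (simp add: nn_integral_cmult nn_integral_add \<nu>.emeasure_space_1 \<mu>.emeasure_space_1
        del: \<nu>.space_eq_univ \<mu>.space_eq_univ)
  also have "\<dots> < \<infinity>"
    using assms by (simp add: ennreal_mult_less_top)
  finally show ?thesis .
qed

text \<open>By Fubini the moment of x + y is finite for \<nu>-almost every fixed y. One such y
  suffices, since undoing a constant shift costs only a factor and a constant. This is how
  finiteness descends from the law at time 1 to a convolution factor of it.\<close>

lemma moment_convolutionD:
  fixes p :: real
  assumes "real_distribution \<mu>" "real_distribution \<nu>" and p: "0 \<le> p"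
    and fin: "(\<integral>\<^sup>+x. ennreal (\<bar>x\<bar> powr p) \<partial>(\<mu> \<star> \<nu>)) < \<infinity>"
  shows "(\<integral>\<^sup>+x. ennreal (\<bar>x\<bar> powr p) \<partial>\<mu>) < \<infinity>"
proof -
  interpret \<mu>: real_distribution \<mu> by fact
  interpret \<nu>: real_distribution \<nu> by fact
  have "(\<integral>\<^sup>+x. ennreal (\<bar>x\<bar> powr p) \<partial>(\<mu> \<star> \<nu>)) = (\<integral>\<^sup>+x. ennreal (\<bar>x\<bar> powr p) \<partial>(\<nu> \<star> \<mu>))"
    by (subst convolution_commutative) (auto simp: \<mu>.finite_measure_axioms \<nu>.finite_measure_axioms)
  also have "\<dots> = (\<integral>\<^sup>+y. \<integral>\<^sup>+x. ennreal (\<bar>y + x\<bar> powr p) \<partial>\<mu> \<partial>\<nu>)"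
    by (intro nn_integral_convolution) (auto simp: \<mu>.finite_measure_axioms \<nu>.finite_measure_axioms)
  finally have "(\<integral>\<^sup>+y. \<integral>\<^sup>+x. ennreal (\<bar>y + x\<bar> powr p) \<partial>\<mu> \<partial>\<nu>) \<noteq> \<infinity>"
    using fin by simp
  then have *: "AE y in \<nu>. (\<integral>\<^sup>+x. ennreal (\<bar>y + x\<bar> powr p) \<partial>\<mu>) \<noteq> \<infinity>"
    by (intro nn_integral_PInf_AE) auto
  obtain y where y: "(\<integral>\<^sup>+x. ennreal (\<bar>y + x\<bar> powr p) \<partial>\<mu>) < \<infinity>"
  proof -
    have "\<not> (AE y in \<nu>. False)"
      by (simp add: \<nu>.AE_False)
    with * show ?thesis
      using that by (force simp: less_top elim: eventually_mono)
  qed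
  have "(\<integral>\<^sup>+x. ennreal (\<bar>x\<bar> powr p) \<partial>\<mu>) \<le>
      (\<integral>\<^sup>+x. ennreal (2 powr p) * (ennreal (\<bar>y + x\<bar> powr p) + ennreal (\<bar>y\<bar> powr p)) \<partial>\<mu>)"
    using abs_add_powr_le[OF p, of "y + _" "- y"]
    by (intro nn_integral_mono) (simp flip: ennreal_plus ennreal_mult)
  also have "\<dots> = ennreal (2 powr p) * ((\<integral>\<^sup>+x. ennreal (\<bar>y + x\<bar> powr p) \<partial>\<mu>) + ennreal (\<bar>y\<bar> powr p))"
    by (simp add: nn_integral_cmult nn_integral_add \<mu>.emeasure_space_1 del: \<mu>.space_eq_univ)
  also have "\<dots> < \<infinity>"
    using y by (simp add: ennreal_mult_less_top)
  finally show ?thesis .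
qed

text \<open>Otherwise there would be times tending to 0 with tails at least \<theta>; by Levy's
  continuity theorem these laws converge weakly to the point mass at 0, which gives the tail set no
  mass. The bound is uniform over all laws with the given exponent, so that it serves grid
  increments of every level as well as increments of the limit.\<close>

lemma small_time_tail:
  fixes \<psi> :: "real \<Rightarrow> complex"
  assumes "0 < \<epsilon>" "0 < \<theta>"
  obtains \<eta> where "0 < \<eta>"
    and "\<And>s \<mu>. 0 \<le> s \<Longrightarrow> s < \<eta> \<Longrightarrow> real_distribution \<mu> \<Longrightarrow> (\<And>u. char \<mu> u = exp (of_real s * \<psi> u)) \<Longrightarrow>
          measure \<mu> {x. \<bar>x\<bar> > \<epsilon>} < \<theta>"
proof -
  have "\<exists>\<eta>>0. \<forall>s \<mu>. 0 \<le> s \<longrightarrow> s < \<eta> \<longrightarrow> real_distribution \<mu> \<longrightarrow> (\<forall>u. char \<mu> u = exp (of_real s * \<psi> u)) \<longrightarrow>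
          measure \<mu> {x. \<bar>x\<bar> > \<epsilon>} < \<theta>"
  proof (rule ccontr)
    assume "\<not> ?thesis"
    then have "\<forall>n. \<exists>s \<mu>. 0 \<le> s \<and> s < 1 / real (Suc n) \<and> real_distribution \<mu> \<and>
        (\<forall>u. char \<mu> u = exp (of_real s * \<psi> u)) \<and> \<not> measure \<mu> {x. \<bar>x\<bar> > \<epsilon>} < \<theta>"
      by (metis of_nat_0_less_iff zero_less_Suc zero_less_divide_1_iff)
    then obtain s \<mu> where s: "\<And>n. 0 \<le> s n" "\<And>n. s n < 1 / real (Suc n)"
      and \<mu>: "\<And>n. real_distribution (\<mu> n)" "\<And>n u. char (\<mu> n) u = exp (of_real (s n) * \<psi> u)"
      and tail: "\<And>n. \<theta> \<le> measure (\<mu> n) {x. \<bar>x\<bar> > \<epsilon>}"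
      by (metis not_less)
    have s0: "s \<longlonglongrightarrow> 0"
      by (rule tendsto_sandwich[OF _ _ tendsto_const LIMSEQ_Suc[OF lim_1_over_n]])
         (use s in \<open>auto intro!: always_eventually less_imp_le\<close>)
    have D: "real_distribution (return borel (0::real))"
      by (auto simp: real_distribution_def real_distribution_axioms_def intro!: prob_space_return)
    have char0: "char (return borel 0) u = 1" for u
      unfolding char_def by (subst integral_return) auto
    have "weak_conv_m \<mu> (return borel 0)"
    proof (rule levy_continuity[OF \<mu>(1) D])
      fix u
      have "(\<lambda>n. exp (of_real (s n) * \<psi> u)) \<longlonglongrightarrow> exp (of_real 0 * \<psi> u)"
        by (intro tendsto_intros s0)
      then show "(\<lambda>n. char (\<mu> n) u) \<longlonglongrightarrow> char (return borel 0) u"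
        by (simp add: \<mu> char0)
    qed
    \<comment> \<open>Weak convergence controls the mass of continuity sets only; the point mass at
      0 charges a frontier only if 0 lies on it.\<close>
    moreover have "0 \<notin> frontier {x::real. \<bar>x\<bar> > \<epsilon>}"
    proof -
      have "closure {x::real. \<bar>x\<bar> > \<epsilon>} \<subseteq> {x. \<epsilon> \<le> \<bar>x\<bar>}"
        by (intro closure_minimal closed_Collect_le continuous_intros) auto
      then have "0 \<notin> closure {x::real. \<bar>x\<bar> > \<epsilon>}"
        using \<open>0 < \<epsilon>\<close> by auto
      then show ?thesis by (simp add: frontier_def)
    qed
    then have "emeasure (return borel 0) (frontier {x::real. \<bar>x\<bar> > \<epsilon>}) = 0"
      by (subst emeasure_return) auto
    ultimately have "(\<lambda>n. measure (\<mu> n) {x. \<bar>x\<bar> > \<epsilon>}) \<longlonglongrightarrow> measure (return borel 0) {x. \<bar>x\<bar> > \<epsilon>}"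
      by (intro weak_conv_imp_continuity_set_conv \<mu>(1) D) auto
    moreover have "measure (return borel 0) {x. \<bar>x\<bar> > \<epsilon>} = 0"
      using \<open>0 < \<epsilon>\<close> by (simp add: measure_return)
    ultimately show False
      using tail \<open>0 < \<theta>\<close> by (auto dest!: LIMSEQ_le_const)
  qed
  then show ?thesis using that by blast
qed

subsection \<open>Densities of a convolution semigroup\<close>

locale levy_densities =
  fixes \<psi> :: "real \<Rightarrow> complex" and f :: "real \<Rightarrow> real \<Rightarrow> real" and T p :: real
  assumes T: "0 < T" and p: "1 \<le> p"
    and dens: "t \<in> {0<..T} \<union> {1} \<Longrightarrow> prob_density_of_char (f t) (\<lambda>u. exp (of_real t * \<psi> u))"
    and moment_1: "integrable lborel (\<lambda>x. \<bar>x\<bar> powr p * f 1 x)"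
begin

abbreviation law :: "real \<Rightarrow> real measure" where
  "law t \<equiv> density lborel (\<lambda>x. ennreal (f t x))"

lemma f_measurable [measurable (raw)]: "t \<in> {0<..T} \<union> {1} \<Longrightarrow> f t \<in> borel_measurable borel"
  and f_nonneg: "t \<in> {0<..T} \<union> {1} \<Longrightarrow> 0 \<le> f t x"
  and prob_space_law: "t \<in> {0<..T} \<union> {1} \<Longrightarrow> prob_space (law t)"
  and char_law: "t \<in> {0<..T} \<union> {1} \<Longrightarrow> char (law t) = (\<lambda>u. exp (of_real t * \<psi> u))"
  using dens[of t] by (auto simp: prob_density_of_char_def)

lemma real_distribution_law: "t \<in> {0<..T} \<union> {1} \<Longrightarrow> real_distribution (law t)"
  by (auto simp: real_distribution_def real_distribution_axioms_def prob_space_law)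

text \<open>Splitting \<open>law 1\<close> at a small time d leaves a remainder over time 1 - d,
  which can exceed \<open>T\<close> and then has no density at hand. A law with the right exponent
  is still an N-fold convolution of the law over s/N, where N > s/T puts the step into the
  admissible range. For s = 0 it is the point mass at 0.\<close>

lemma ex_law:
  assumes "0 \<le> s"
  shows "\<exists>\<nu>. real_distribution \<nu> \<and> (\<forall>u. char \<nu> u = exp (of_real s * \<psi> u))"
proof -
  obtain N :: nat where N: "s / T < real N" using reals_Archimedean2 by blast
  have N0: "0 < real N" using N assms T by (meson divide_nonneg_pos le_less_trans)
  define h where "h = s / N"
  have h: "0 \<le> h" "h \<le> T" "s = real N * h"
    using N N0 assms T by (auto simp: h_def field_simps)
  have "\<exists>\<nu>. real_distribution \<nu> \<and> (\<forall>u. char \<nu> u = exp (of_real (real k * h) * \<psi> u))" for k :: nat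
  proof (induction k)
    case 0
    have "real_distribution (return borel (0::real))"
      by (auto simp: real_distribution_def real_distribution_axioms_def intro!: prob_space_return)
    moreover have "char (return borel 0) u = 1" for u
      unfolding char_def by (subst integral_return) auto
    ultimately show ?case by auto
  next
    case (Suc k)
    show ?case
    proof (cases "h = 0")
      case True
      with Suc show ?thesis by auto
    next
      case False
      then have h': "h \<in> {0<..T} \<union> {1}" using h by auto
      obtain \<nu> where \<nu>: "real_distribution \<nu>" "\<And>u. char \<nu> u = exp (of_real (real k * h) * \<psi> u)"
        using Suc by auto
      then show ?thesis
        using real_distribution_law[OF h'] char_law[OF h']
        by (intro exI[of _ "law h \<star> \<nu>"])
           (auto simp: char_convolution real_distribution_convolution exp_add[symmetric] algebra_simps)
    qed
  qed
  from this[of N] show ?thesis by (simp add: h)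
qed

lemma law_eqI:
  assumes "t \<in> {0<..T} \<union> {1}" "real_distribution \<nu>" "\<And>u. char \<nu> u = exp (of_real t * \<psi> u)"
  shows "law t = \<nu>"
  using assms by (intro Levy_uniqueness real_distribution_law) (auto simp: char_law)

lemma law_convolution:
  assumes "s \<in> {0<..T} \<union> {1}" "t \<in> {0<..T} \<union> {1}" "s + t \<in> {0<..T} \<union> {1}"
  shows "law (s + t) = (law s \<star> law t)"
  using assms
  by (intro law_eqI) (auto simp: real_distribution_convolution real_distribution_law char_convolution
      char_law exp_add[symmetric] algebra_simps)

text \<open>Time 1, where the moment is known, and time h need not be multiples of each other. The
  detour goes through \<open>d = h / N\<close> with N > h: \<open>law d\<close> is a convolution
  factor of \<open>law 1\<close> because d \<le> 1, and \<open>law h\<close> is the N-fold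
  convolution power of \<open>law d\<close>.\<close>

lemma law_moment:
  assumes h: "0 < h" "h \<le> T"
  shows "(\<integral>\<^sup>+x. ennreal (\<bar>x\<bar> powr p) \<partial>law h) < \<infinity>"
proof -
  obtain N :: nat where N: "h < real N" using reals_Archimedean2 by blast
  have N0: "1 \<le> real N" "0 < N" using N h by (auto simp: Suc_le_eq)
  define d where "d = h / N"
  have "h / N \<le> h" using N0 h by (simp add: field_simps mult_left_le)
  moreover have "h / N \<le> T" using calculation h by simp
  ultimately have d: "0 < d" "d \<le> T" "d \<le> 1" "h = real N * d" "d \<le> h"
    using N N0 h T unfolding d_def by (auto simp: field_simps intro: order_trans)
  have m1: "(\<integral>\<^sup>+x. ennreal (\<bar>x\<bar> powr p) \<partial>law 1) < \<infinity>"
  proof -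
    have "(\<integral>\<^sup>+x. ennreal (\<bar>x\<bar> powr p) \<partial>law 1) = (\<integral>\<^sup>+x. ennreal (\<bar>x\<bar> powr p * f 1 x) \<partial>lborel)"
      by (subst nn_integral_density) (auto simp: f_nonneg ennreal_mult mult.commute)
    also have "\<dots> < \<infinity>"
      using moment_1 by (auto simp: real_integrable_def less_top)
    finally show ?thesis .
  qed
  have md: "(\<integral>\<^sup>+x. ennreal (\<bar>x\<bar> powr p) \<partial>law d) < \<infinity>"
  proof -
    obtain \<nu> where \<nu>: "real_distribution \<nu>" "\<And>u. char \<nu> u = exp (of_real (1 - d) * \<psi> u)"
      using ex_law[of "1 - d"] d by auto
    have "law 1 = (law d \<star> \<nu>)"
      using d \<nu> by (intro law_eqI) (auto simp: real_distribution_convolution real_distribution_law char_convolution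
          char_law exp_add[symmetric] algebra_simps)
    then show ?thesis
      using moment_convolutionD[of "law d" \<nu> p] m1 \<nu> d p real_distribution_law[of d] by auto
  qed
  \<comment> \<open>Only multiples up to h are considered, so that all times stay in (0,T];
    \<open>Suc k\<close> avoids time 0, which has no density.\<close>
  have "real (Suc k) * d \<le> h \<Longrightarrow> (\<integral>\<^sup>+x. ennreal (\<bar>x\<bar> powr p) \<partial>law (real (Suc k) * d)) < \<infinity>" for k
  proof (induction k)
    case 0
    then show ?case using md by simp
  next
    case (Suc k)
    have k: "real (Suc k) * d \<in> {0<..T} \<union> {1}" "real (Suc k) * d \<le> h"
      using Suc.prems d h by (auto simp: distrib_right intro!: add_pos_nonneg)
    have *: "real (Suc (Suc k)) * d = real (Suc k) * d + d" by (simp add: algebra_simps)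
    have "law (real (Suc (Suc k)) * d) = (law (real (Suc k) * d) \<star> law d)"
      unfolding * using Suc.prems d h k by (intro law_convolution) (auto simp: distrib_right)
    then show ?case
      using moment_convolution[of "law (real (Suc k) * d)" "law d" p] Suc.IH k d p md
        real_distribution_law[OF k(1)] real_distribution_law[of d] by auto
  qed
  from this[of "N - 1"] show ?thesis using N0 d by simp
qed

text \<open>Equal laws determine densities only almost everywhere. On an exceptional null set of
  endpoints y the bridge density may fail to have integral 1; this is harmless because the endpoint
  increment has itself an absolutely continuous law.\<close>

lemma density_convolution_AE:
  assumes h: "0 < h" "2 * h \<le> T"
  shows "AE y in lborel. ennreal (f (2 * h) y) = (\<integral>\<^sup>+x. ennreal (f h x * f h (y - x)) \<partial>lborel)"
proof -
  have [measurable]: "f h \<in> borel_measurable borel" "f (2 * h) \<in> borel_measurable borel"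
    using h by auto
  have [simp]: "0 \<le> f h x" for x using h by (auto intro: f_nonneg)
  have fin: "finite_measure (law h)"
    using prob_space_law[of h] h by (auto intro: prob_space.finite_measure)
  have "law (2 * h) = (law h \<star> law h)"
    using law_convolution[of h h] h by simp
  also have "\<dots> = density lborel (\<lambda>x. \<integral>\<^sup>+y. ennreal (f h (x - y)) * ennreal (f h y) \<partial>lborel)"
    by (intro convolution_density fin) auto
  finally have "AE y in lborel. ennreal (f (2 * h) y) = (\<integral>\<^sup>+x. ennreal (f h (y - x)) * ennreal (f h x) \<partial>lborel)"
    by (subst (asm) sigma_finite_measure.density_unique_iff[OF lborel.sigma_finite_measure_axioms]) auto
  then show ?thesis
    by (simp add: mult.commute flip: ennreal_mult)
qed

end

section \<open>The bridge kernel as a pair of independent halves\<close>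

lemma prod_lessThan_pairs:
  fixes g :: "nat \<Rightarrow> 'b::comm_monoid_mult"
  shows "(\<Prod>j<2 * m. g j) = (\<Prod>k<m. g (2 * k) * g (2 * k + 1))"
  by (induction m) (auto simp: mult_ac)

lemma sets_fst_and_sum:
  fixes A B :: "real set"
  assumes [measurable]: "A \<in> sets borel" "B \<in> sets borel"
  shows "{(u, v). u \<in> B \<and> u + v \<in> A} \<in> sets (borel \<Otimes>\<^sub>M borel)"
proof -
  have "{(u, v). u \<in> B \<and> u + v \<in> A} =
      {z \<in> space (borel \<Otimes>\<^sub>M borel). fst z \<in> B \<and> fst z + snd z \<in> A}"
    by (auto simp: space_pair_measure)
  also have "\<dots> \<in> sets (borel \<Otimes>\<^sub>M borel)" by measurable
  finally show ?thesis .
qed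

context levy_densities
begin

text \<open>\<open>q y\<close> is the bridge probability that the first half lies in B, given the
  full increment y. Weighting with the density of y cancels the denominator and leaves the product
  density of the two halves; substituting y = x + v then turns the bridge into an independent
  pair.\<close>

lemma bridge_kernel:
  fixes A B :: "real set"
  assumes h: "0 < h" "2 * h \<le> T" and [measurable]: "A \<in> sets borel" "B \<in> sets borel"
  defines "q \<equiv> \<lambda>y. LINT x:B|lborel. f h x * f h (y - x) / f (2 * h) y"
  shows "q \<in> borel_measurable borel" and "0 \<le> q y"
    and "(\<integral>\<^sup>+y. ennreal (indicator A y * q y) \<partial>law (2 * h)) =
      emeasure (law h \<Otimes>\<^sub>M law h) {(u, v). u \<in> B \<and> u + v \<in> A}"
proof -
  have [measurable]: "f h \<in> borel_measurable borel" "f (2 * h) \<in> borel_measurable borel"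
    using h by auto
  have S [measurable]: "{(u, v). u \<in> B \<and> u + v \<in> A} \<in> sets (borel \<Otimes>\<^sub>M borel)"
    by (rule sets_fst_and_sum) auto
  have nn [simp]: "0 \<le> f h x" "0 \<le> f (2 * h) x" for x using h by (auto intro: f_nonneg)
  have q_meas [measurable]: "q \<in> borel_measurable borel"
    unfolding q_def set_lebesgue_integral_def by measurable
  then show "q \<in> borel_measurable borel" .
  have q_nonneg [simp]: "0 \<le> q y" for y
    unfolding q_def set_lebesgue_integral_def by (intro integral_nonneg_AE) auto
  then show "0 \<le> q y" .
  interpret prob_space "law h" using h by (intro prob_space_law) auto
  \<comment> \<open>Where the denominator vanishes, the convolution integral vanishes too, so both
    sides are 0 whatever the division by zero returns.\<close>
  have *: "ennreal (f (2 * h) y) * ennreal (q y) = (\<integral>\<^sup>+x. indicator B x * ennreal (f h x * f h (y - x)) \<partial>lborel)"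
    if y: "ennreal (f (2 * h) y) = (\<integral>\<^sup>+x. ennreal (f h x * f h (y - x)) \<partial>lborel)" for y
  proof (cases "f (2 * h) y = 0")
    case True
    have "(\<integral>\<^sup>+x. indicator B x * ennreal (f h x * f h (y - x)) \<partial>lborel) \<le>
        (\<integral>\<^sup>+x. ennreal (f h x * f h (y - x)) \<partial>lborel)"
      by (intro nn_integral_mono) (auto split: split_indicator)
    also have "\<dots> = 0" using y True by simp
    finally show ?thesis using True by simp
  next
    case False
    then have pos: "0 < f (2 * h) y" using nn(2)[of y] by linarith
    let ?g = "\<lambda>x. f h x * f h (y - x)"
    \<comment> \<open>\<open>q\<close> is a Bochner integral, which would be 0 by convention without
      integrability; the finite value \<open>f (2 * h) y\<close> of the convolution integral
      excludes this.\<close>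
    have "integrable lborel ?g"
      by (rule integrableI_nonneg) (auto simp flip: y)
    then have int: "integrable lborel (\<lambda>x. indicator B x * (?g x / f (2 * h) y))"
      by (intro integrable_real_mult_indicator[unfolded mult.commute[of _ "indicator _ _"]]
          integrable_divide_zero) auto
    have "ennreal (q y) = (\<integral>\<^sup>+x. ennreal (indicator B x * (?g x / f (2 * h) y)) \<partial>lborel)"
      unfolding q_def set_lebesgue_integral_def
      by (subst nn_integral_eq_integral[OF int]) auto
    then have "ennreal (f (2 * h) y) * ennreal (q y) =
        (\<integral>\<^sup>+x. ennreal (f (2 * h) y) * ennreal (indicator B x * (?g x / f (2 * h) y)) \<partial>lborel)"
      by (simp add: nn_integral_cmult)
    also have "\<dots> = (\<integral>\<^sup>+x. indicator B x * ennreal (?g x) \<partial>lborel)"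
      using pos by (intro nn_integral_cong) (auto simp flip: ennreal_mult split: split_indicator)
    finally show ?thesis .
  qed
  have "(\<integral>\<^sup>+y. ennreal (indicator A y * q y) \<partial>law (2 * h)) =
      (\<integral>\<^sup>+y. ennreal (f (2 * h) y) * ennreal (indicator A y * q y) \<partial>lborel)"
    by (subst nn_integral_density) auto
  also have "\<dots> = (\<integral>\<^sup>+y. indicator A y * (\<integral>\<^sup>+x. indicator B x * ennreal (f h x * f h (y - x)) \<partial>lborel) \<partial>lborel)"
    using density_convolution_AE[OF h]
    by (intro nn_integral_cong_AE, eventually_elim) (use * in \<open>auto split: split_indicator\<close>)
  also have "\<dots> = (\<integral>\<^sup>+y. \<integral>\<^sup>+x. indicator A y * (indicator B x * ennreal (f h x * f h (y - x))) \<partial>lborel \<partial>lborel)"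
    by (rule nn_integral_cong, rule nn_integral_cmult[symmetric]) auto
  also have "\<dots> = (\<integral>\<^sup>+x. \<integral>\<^sup>+y. indicator A y * (indicator B x * ennreal (f h x * f h (y - x))) \<partial>lborel \<partial>lborel)"
    by (rule lborel_pair.Fubini') measurable
  also have "\<dots> = (\<integral>\<^sup>+x. \<integral>\<^sup>+v. indicator A (x + v) * (indicator B x * ennreal (f h x * f h v)) \<partial>lborel \<partial>lborel)"
  proof (rule nn_integral_cong)
    fix x
    show "(\<integral>\<^sup>+y. indicator A y * (indicator B x * ennreal (f h x * f h (y - x))) \<partial>lborel) =
        (\<integral>\<^sup>+v. indicator A (x + v) * (indicator B x * ennreal (f h x * f h v)) \<partial>lborel)"
      by (subst nn_integral_real_affine[where c = 1 and t = x]) auto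
  qed
  also have "\<dots> = (\<integral>\<^sup>+x. ennreal (f h x) * (\<integral>\<^sup>+v. ennreal (f h v) * indicator {(u, v). u \<in> B \<and> u + v \<in> A} (x, v) \<partial>lborel) \<partial>lborel)"
    by (rule nn_integral_cong, subst nn_integral_cmult[symmetric])
       (auto intro!: nn_integral_cong measurable_compose[OF measurable_Pair1'[of _ borel borel]] simp: ennreal_mult split: split_indicator)
  also have "\<dots> = (\<integral>\<^sup>+x. \<integral>\<^sup>+v. indicator {(u, v). u \<in> B \<and> u + v \<in> A} (x, v) \<partial>law h \<partial>law h)"
    by (simp add: nn_integral_density)
  also have "\<dots> = emeasure (law h \<Otimes>\<^sub>M law h) {(u, v). u \<in> B \<and> u + v \<in> A}"
    by (subst nn_integral_fst) (auto simp: measurable_split_conv)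
  finally show "(\<integral>\<^sup>+y. ennreal (indicator A y * q y) \<partial>law (2 * h)) =
      emeasure (law h \<Otimes>\<^sub>M law h) {(u, v). u \<in> B \<and> u + v \<in> A}" .
qed

end

subsection \<open>Independence of the grid increments\<close>

locale bridge_setup = levy_densities \<psi> f T p + prob_space M
  for \<psi> :: "real \<Rightarrow> complex" and f :: "real \<Rightarrow> real \<Rightarrow> real" and T p :: real and M :: "'a measure" +
  fixes X :: "nat \<Rightarrow> nat \<Rightarrow> 'a \<Rightarrow> real"
  assumes sampling: "bridge_sampling M T f X"
begin

lemma X_measurable [measurable (raw)]: "j \<le> 2 ^ n \<Longrightarrow> X n j \<in> borel_measurable M"
  and X_0_0: "\<omega> \<in> space M \<Longrightarrow> X 0 0 \<omega> = 0"
  and X_0_1: "distributed M lborel (X 0 1) (\<lambda>x. ennreal (f T x))"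
  using sampling unfolding bridge_sampling_def by auto

lemma X_refine: "\<lbrakk>k \<le> 2 ^ n; \<omega> \<in> space M\<rbrakk> \<Longrightarrow> X (Suc n) (2 * k) \<omega> = X n k \<omega>"
proof -
  assume a: "k \<le> 2 ^ n" "\<omega> \<in> space M"
  have "\<forall>i\<ge>1. \<forall>j\<le>2 ^ i. even j \<longrightarrow> (\<forall>\<omega>\<in>space M. X i j \<omega> = X (i - 1) (j div 2) \<omega>)"
    using sampling unfolding bridge_sampling_def by blast
  from this[rule_format, of "Suc n" "2 * k" \<omega>] a show ?thesis by simp
qed

lemma X_refine_iter: "\<lbrakk>k \<le> 2 ^ n; \<omega> \<in> space M\<rbrakk> \<Longrightarrow> X (m + n) (2 ^ m * k) \<omega> = X n k \<omega>"
proof (induction m)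
  case (Suc m)
  have "2 ^ m * k \<le> 2 ^ (m + n)" using Suc.prems by (simp add: power_add)
  from X_refine[OF this Suc.prems(2)] Suc show ?case by (simp add: mult.assoc)
qed simp

lemma X_0: "\<omega> \<in> space M \<Longrightarrow> X n 0 \<omega> = 0"
  using X_refine_iter[of 0 0 \<omega> n] X_0_0[of \<omega>] by simp

definition incr :: "nat \<Rightarrow> nat \<Rightarrow> 'a \<Rightarrow> real" where
  "incr n j \<omega> = X n (Suc j) \<omega> - X n j \<omega>"

lemma incr_measurable [measurable (raw)]: "j < 2 ^ n \<Longrightarrow> incr n j \<in> borel_measurable M"
  unfolding incr_def[abs_def] by measurable

lemma incr_refine:
  "\<lbrakk>k < 2 ^ n; \<omega> \<in> space M\<rbrakk> \<Longrightarrow> incr n k \<omega> = incr (Suc n) (2 * k) \<omega> + incr (Suc n) (2 * k + 1) \<omega>"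
  using X_refine[of k n \<omega>] X_refine[of "Suc k" n \<omega>] by (simp add: incr_def)

lemma subalgebra_level_algebra: "subalgebra M (level_algebra M X n)"
  unfolding subalgebra_def level_algebra_def
  by (auto intro!: sets.sigma_sets_subset simp: sets_measure_of_conv space_measure_of_conv)

lemma X_measurable_level_algebra: "j \<le> 2 ^ n \<Longrightarrow> X n j \<in> borel_measurable (level_algebra M X n)"
  by (rule measurableI) (auto simp: level_algebra_def sets_measure_of_conv space_measure_of_conv intro!: sigma_sets.Basic)

text \<open>The sampling clause gives conditional probabilities of product sets, hence the
  restriction to rectangles. The coarse event \<open>EA\<close> is measurable for the conditioning
  algebra and can be pulled into the conditional expectation. The conditional probability of
  \<open>EB\<close> is a product of functions of single coarse increments, and these are independent
  by \<open>IH\<close>, so the expectation factorises into the integrals of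
  \<open>bridge_kernel\<close>.\<close>

lemma rectangle_prob:
  fixes A B :: "nat \<Rightarrow> real set"
  assumes AB [measurable]: "\<And>k. A k \<in> sets borel" "\<And>k. B k \<in> sets borel"
    and IH: "distr M (PiM {..<2 ^ n} (\<lambda>_. borel)) (\<lambda>\<omega>. \<lambda>k\<in>{..<2 ^ n}. incr n k \<omega>) = PiM {..<2 ^ n} (\<lambda>_. law (T / 2 ^ n))"
  defines "h \<equiv> T / 2 ^ Suc n"
  shows "emeasure M {\<omega> \<in> space M. \<forall>k<2 ^ n. incr n k \<omega> \<in> A k \<and> incr (Suc n) (2 * k) \<omega> \<in> B k} =
    (\<Prod>k<2 ^ n. emeasure (law h \<Otimes>\<^sub>M law h) {(u, v). u \<in> B k \<and> u + v \<in> A k})"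
proof -
  let ?I = "{..<2 ^ n :: nat}"
  have h: "0 < h" "2 * h \<le> T" "2 * h = T / 2 ^ n"
    using T unfolding h_def by (auto simp: field_simps)
  define q where "q k y = (LINT x:B k|lborel. f h x * f h (y - x) / f (2 * h) y)" for k y
  have q_meas [measurable]: "q k \<in> borel_measurable borel" and q_nonneg: "0 \<le> q k y"
    and q_int: "(\<integral>\<^sup>+y. ennreal (indicator (A k) y * q k y) \<partial>law (2 * h)) =
      emeasure (law h \<Otimes>\<^sub>M law h) {(u, v). u \<in> B k \<and> u + v \<in> A k}" for k y
    using bridge_kernel[OF h(1,2) AB(1)[of k] AB(2)[of k]] unfolding q_def[abs_def] by blast+
  define EA where "EA = {\<omega> \<in> space M. \<forall>k<2 ^ n. incr n k \<omega> \<in> A k}"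
  define EB where "EB = {\<omega> \<in> space M. \<forall>k<2 ^ n. incr (Suc n) (2 * k) \<omega> \<in> B k}"
  let ?G = "level_algebra M X n"
  interpret G: finite_measure_subalgebra M ?G
    by unfold_locales (rule subalgebra_level_algebra)
  have EA_G [measurable]: "EA \<in> sets ?G"
  proof -
    have [measurable]: "k < 2 ^ n \<Longrightarrow> incr n k \<in> borel_measurable ?G" for k
      unfolding incr_def[abs_def] by (intro borel_measurable_diff X_measurable_level_algebra) auto
    have "space ?G = space M" using subalgebra_level_algebra by (simp add: subalgebra_def)
    then have "EA = {\<omega> \<in> space ?G. \<forall>k\<in>?I. incr n k \<omega> \<in> A k}" by (auto simp: EA_def)
    also have "\<dots> \<in> sets ?G" by measurable
    finally show ?thesis .
  qed
  have EA_M [measurable]: "EA \<in> sets M"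
    using EA_G subalgebra_level_algebra[of n] unfolding subalgebra_def by blast
  have EB_M [measurable]: "EB \<in> sets M"
  proof -
    have "EB = {\<omega> \<in> space M. \<forall>k\<in>?I. incr (Suc n) (2 * k) \<omega> \<in> B k}" by (auto simp: EB_def)
    also have "\<dots> \<in> sets M" by measurable
    finally show ?thesis .
  qed
  \<comment> \<open>The sampling clause indexes a new increment by its odd right endpoint,
    \<open>incr\<close> by the left one: j = 2k + 1 corresponds to
    \<open>incr (Suc n) (2 * k)\<close>, and \<open>j div 2\<close> recovers k.\<close>
  let ?K = "{j. j < 2 ^ Suc n \<and> odd j}"
  have K: "?K = (\<lambda>k. 2 * k + 1) ` ?I"
    by (auto simp: image_iff elim!: oddE)
  have EB': "{\<omega> \<in> space M. \<forall>j<2 ^ Suc n. odd j \<longrightarrow> X (Suc n) j \<omega> - X (Suc n) (j - 1) \<omega> \<in> B (j div 2)} = EB"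
  proof -
    have "(\<forall>j<2 ^ Suc n. odd j \<longrightarrow> X (Suc n) j \<omega> - X (Suc n) (j - 1) \<omega> \<in> B (j div 2)) \<longleftrightarrow>
        (\<forall>j\<in>?K. X (Suc n) j \<omega> - X (Suc n) (j - 1) \<omega> \<in> B (j div 2))" for \<omega> by auto
    then show ?thesis unfolding K EB_def by (auto simp: incr_def)
  qed
  have "AE \<omega> in M. real_cond_exp M ?G (indicator EB) \<omega> =
      (\<Prod>j\<in>?K. LINT x:B (j div 2)|lborel. bridge_density f T (Suc n) (X (Suc n) (j + 1) \<omega> - X (Suc n) (j - 1) \<omega>) x)"
  proof -
    have "\<forall>i\<ge>1. \<forall>B. (\<forall>j. B j \<in> sets borel) \<longrightarrow>
        (AE \<omega> in M.
           real_cond_exp M (level_algebra M X (i - 1))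
             (indicator {\<omega>\<in>space M. \<forall>j<2 ^ i. odd j \<longrightarrow> X i j \<omega> - X i (j - 1) \<omega> \<in> B j}) \<omega> =
           (\<Prod>j\<in>{j. j < 2 ^ i \<and> odd j}.
              LINT x:B j|lborel. bridge_density f T i (X i (j + 1) \<omega> - X i (j - 1) \<omega>) x))"
      using sampling unfolding bridge_sampling_def by blast
    from this[rule_format, of "Suc n" "\<lambda>j. B (j div 2)"] show ?thesis
      unfolding EB' by simp
  qed
  moreover have "(\<Prod>j\<in>?K. LINT x:B (j div 2)|lborel. bridge_density f T (Suc n) (X (Suc n) (j + 1) \<omega> - X (Suc n) (j - 1) \<omega>) x) =
      (\<Prod>k<2 ^ n. q k (incr n k \<omega>))" if "\<omega> \<in> space M" for \<omega>
  proof -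
    have "X (Suc n) (2 * k + 2) \<omega> - X (Suc n) (2 * k) \<omega> = incr n k \<omega>" if "k < 2 ^ n" for k
      using X_refine[of k n \<omega>] X_refine[of "Suc k" n \<omega>] that \<open>\<omega> \<in> space M\<close> by (simp add: incr_def)
    then show ?thesis
      unfolding K by (subst prod.reindex) (auto simp: inj_on_def q_def bridge_density_def[abs_def] h(3) h_def intro!: prod.cong)
  qed
  ultimately have cond: "AE \<omega> in M. real_cond_exp M ?G (indicator EB) \<omega> = (\<Prod>k<2 ^ n. q k (incr n k \<omega>))"
    by (auto elim!: AE_mp intro!: AE_I2)
  have ind: "indicator EA \<omega> = (\<Prod>k<2 ^ n. indicator (A k) (incr n k \<omega>) :: real)" if "\<omega> \<in> space M" for \<omega>
    using that by (auto simp: EA_def indicator_def prod_eq_1_iff not_less intro!: prod.neutral prod_zero[symmetric])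
  interpret L: prob_space "law (T / 2 ^ n)"
    using h by (intro prob_space_law) auto
  interpret P: product_sigma_finite "\<lambda>_. law (T / 2 ^ n)" ..
  interpret L1: prob_space "law h" using h by (intro prob_space_law) auto
  interpret L2: pair_prob_space "law h" "law h" ..
  have le1: "emeasure (law h \<Otimes>\<^sub>M law h) S \<le> 1" for S
    by (rule L2.P.emeasure_le_1)
  have int: "integrable (law (T / 2 ^ n)) (\<lambda>y. indicator (A k) y * q k y)" for k
    using q_int[of k] le1[of "{(u, v). u \<in> B k \<and> u + v \<in> A k}"] q_nonneg
    by (intro integrableI_nonneg) (auto simp: h(3) le_less_trans[OF _ ennreal_one_less_top])
  have "measure M (EA \<inter> EB) = (\<integral>\<omega>. indicator EA \<omega> * indicator EB \<omega> \<partial>M)"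
    by (simp flip: indicator_inter_arith)
  also have "\<dots> = (\<integral>\<omega>. indicator EA \<omega> * real_cond_exp M ?G (indicator EB) \<omega> \<partial>M)"
    by (intro G.real_cond_exp_intg(2)[symmetric] integrable_const_bound[of _ 1])
       (auto split: split_indicator)
  also have "\<dots> = (\<integral>\<omega>. (\<Prod>k<2 ^ n. indicator (A k) (incr n k \<omega>) * q k (incr n k \<omega>)) \<partial>M)"
  proof (intro integral_cong_AE)
    show "AE \<omega> in M. indicator EA \<omega> * real_cond_exp M ?G (indicator EB) \<omega> =
        (\<Prod>k<2 ^ n. indicator (A k) (incr n k \<omega>) * q k (incr n k \<omega>))"
      using cond AE_space by eventually_elim (simp add: ind prod.distrib)
  qed measurable
  also have "\<dots> = (\<integral>y. (\<Prod>k<2 ^ n. indicator (A k) (y k) * q k (y k)) \<partial>distr M (PiM ?I (\<lambda>_. borel)) (\<lambda>\<omega>. \<lambda>k\<in>?I. incr n k \<omega>))"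
    by (subst integral_distr) auto
  also have "\<dots> = (\<Prod>k<2 ^ n. \<integral>y. indicator (A k) y * q k y \<partial>law (T / 2 ^ n))"
    unfolding IH by (intro P.product_integral_prod int) auto
  finally have "emeasure M (EA \<inter> EB) = (\<Prod>k<2 ^ n. ennreal (\<integral>y. indicator (A k) y * q k y \<partial>law (T / 2 ^ n)))"
    using q_nonneg by (simp add: emeasure_eq_measure prod_ennreal)
  also have "\<dots> = (\<Prod>k<2 ^ n. emeasure (law h \<Otimes>\<^sub>M law h) {(u, v). u \<in> B k \<and> u + v \<in> A k})"
    using q_nonneg by (simp add: q_int[symmetric] h(3) nn_integral_eq_integral[OF int])
  also have "EA \<inter> EB = {\<omega> \<in> space M. \<forall>k<2 ^ n. incr n k \<omega> \<in> A k \<and> incr (Suc n) (2 * k) \<omega> \<in> B k}"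
    by (auto simp: EA_def EB_def)
  finally show ?thesis .
qed

text \<open>The induction step rests on a linear change of variables: a coarse increment and its
  first half determine both halves. \<open>V\<close> holds these data for the sampled process, and
  \<open>V'\<close> holds (u + v, u) for independent pairs (u, v). By \<open>rectangle_prob\<close>
  both have the same law, and \<open>W\<close> converts either of them into fine increments.\<close>

lemma distr_incr:
  "distr M (PiM {..<2 ^ n} (\<lambda>_. borel)) (\<lambda>\<omega>. \<lambda>k\<in>{..<2 ^ n}. incr n k \<omega>) =
    PiM {..<2 ^ n} (\<lambda>_. law (T / 2 ^ n))"
proof (induction n)
  case 0
  interpret L: prob_space "law T" using T by (intro prob_space_law) auto
  interpret P: product_sigma_finite "\<lambda>_. law T" ..
  have "distr M borel (X 0 1) = law T"
    using distributed_distr_eq_density[OF X_0_1] by (simp cong: distr_cong)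
  moreover have "distr M borel (incr 0 0) = distr M borel (X 0 1)"
    using X_0[of _ 0] by (intro distr_cong) (auto simp: incr_def)
  ultimately have d: "distr M borel (incr 0 0) = law T" by simp
  have I0: "{..<1 :: nat} = {0}" by auto
  show ?case
    unfolding power_0 div_by_1 I0
  proof (rule P.PiM_eqI)
    fix C :: "nat \<Rightarrow> real set" assume C: "\<And>i. i \<in> {0} \<Longrightarrow> C i \<in> sets (law T)"
    have "Pi\<^sub>E {0} C \<in> sets (PiM {0} (\<lambda>_. borel))"
      using C by (intro sets_PiM_I_finite) auto
    then have "emeasure (distr M (PiM {0} (\<lambda>_. borel)) (\<lambda>\<omega>. \<lambda>k\<in>{0}. incr 0 k \<omega>)) (Pi\<^sub>E {0} C) =
        emeasure M ((\<lambda>\<omega>. \<lambda>k\<in>{0}. incr 0 k \<omega>) -` Pi\<^sub>E {0} C \<inter> space M)"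
      by (intro emeasure_distr measurable_restrict) auto
    also have "(\<lambda>\<omega>. \<lambda>k\<in>{0}. incr 0 k \<omega>) -` Pi\<^sub>E {0} C \<inter> space M = incr 0 0 -` C 0 \<inter> space M"
      by auto
    also have "emeasure M \<dots> = emeasure (law T) (C 0)"
      using C unfolding d[symmetric] by (subst emeasure_distr) auto
    also have "\<dots> = (\<Prod>i\<in>{0}. emeasure (law T) (C i))" by simp
    finally show "emeasure (distr M (PiM {0} (\<lambda>_. borel)) (\<lambda>\<omega>. \<lambda>k\<in>{0}. incr 0 k \<omega>)) (Pi\<^sub>E {0} C) =
        (\<Prod>i\<in>{0}. emeasure (law T) (C i))" .
  qed (auto cong: sets_PiM_cong)
next
  case (Suc n)
  let ?I = "{..<2 ^ n :: nat}" and ?J = "{..<2 ^ Suc n :: nat}"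
  define h where "h = T / 2 ^ Suc n"
  have h: "0 < h" "h \<le> T"
    using T one_le_power[of "2::real" "Suc n"] unfolding h_def by (auto simp: field_simps simp del: one_le_power power_Suc)
  interpret L: prob_space "law h" using h by (intro prob_space_law) auto
  interpret L2: pair_prob_space "law h" "law h" ..
  interpret P1: product_sigma_finite "\<lambda>_. law h" ..
  interpret P2: product_prob_space "\<lambda>_::nat. law h \<Otimes>\<^sub>M law h" ..
  define N where "N = PiM ?I (\<lambda>_. law h \<Otimes>\<^sub>M law h)"
  interpret N: prob_space N unfolding N_def by (rule prob_space_PiM) (rule L2.P.prob_space_axioms)
  \<comment> \<open>The boolean marks the kind of entry: \<open>True\<close> for the coarse
    increment, \<open>False\<close> for its first half.\<close>
  let ?K = "?I \<times> (UNIV :: bool set)"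
  let ?P = "PiM ?K (\<lambda>_. borel :: real measure)"
  define V where "V = (\<lambda>\<omega>. \<lambda>i\<in>?K. if snd i then incr n (fst i) \<omega> else incr (Suc n) (2 * fst i) \<omega>)"
  define V' where "V' = (\<lambda>z :: nat \<Rightarrow> real \<times> real. \<lambda>i\<in>?K. if snd i then fst (z (fst i)) + snd (z (fst i)) else fst (z (fst i)))"
  define W where "W = (\<lambda>v :: nat \<times> bool \<Rightarrow> real. \<lambda>j\<in>?J. if even j then v (j div 2, False) else v (j div 2, True) - v (j div 2, False))"
  have [measurable]: "V \<in> measurable M ?P"
    unfolding V_def
  proof (rule measurable_restrict)
    fix i assume "i \<in> ?K"
    then show "(\<lambda>\<omega>. if snd i then incr n (fst i) \<omega> else incr (Suc n) (2 * fst i) \<omega>) \<in> borel_measurable M"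
      by (cases "snd i") (auto simp: mem_Times_iff)
  qed
  have [measurable]: "V' \<in> measurable N ?P"
    unfolding V'_def
  proof (rule measurable_restrict)
    fix i assume "i \<in> ?K"
    then have "(\<lambda>z. z (fst i)) \<in> measurable N (law h \<Otimes>\<^sub>M law h)"
      unfolding N_def by (intro measurable_component_singleton) auto
    also have "measurable N (law h \<Otimes>\<^sub>M law h) = measurable N (borel \<Otimes>\<^sub>M borel)"
      by (intro measurable_cong_sets sets_pair_measure_cong) auto
    finally have [measurable]: "(\<lambda>z. z (fst i)) \<in> measurable N (borel \<Otimes>\<^sub>M borel)" .
    show "(\<lambda>z. if snd i then fst (z (fst i)) + snd (z (fst i)) else fst (z (fst i))) \<in> borel_measurable N"
      by measurable
  qed
  have [measurable]: "W \<in> measurable ?P (PiM ?J (\<lambda>_. borel))"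
    unfolding W_def
  proof (rule measurable_restrict)
    fix j assume "j \<in> ?J"
    then have "(j div 2, b) \<in> ?K" for b by (auto simp: less_mult_imp_div_less)
    then have [measurable]: "(\<lambda>v. v (j div 2, b)) \<in> borel_measurable ?P" for b
      by (rule measurable_component_singleton)
    show "(\<lambda>v. if even j then v (j div 2, False) else v (j div 2, True) - v (j div 2, False)) \<in> borel_measurable ?P"
      by measurable
  qed
  have VV': "distr M ?P V = distr N ?P V'"
  proof (rule measure_eqI_PiM_finite[where I = ?K and M = "\<lambda>_. borel"])
    fix C :: "nat \<times> bool \<Rightarrow> real set" assume "\<And>i. i \<in> ?K \<Longrightarrow> C i \<in> sets borel"
    \<comment> \<open>Outside the index range \<open>UNIV\<close> is taken, as
      \<open>rectangle_prob\<close> asks for Borel sets at every k.\<close>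
    define A where "A k = (if k < 2 ^ n then C (k, True) else UNIV)" for k
    define B where "B k = (if k < 2 ^ n then C (k, False) else UNIV)" for k
    have [measurable]: "A k \<in> sets borel" "B k \<in> sets borel" for k
      using \<open>\<And>i. i \<in> ?K \<Longrightarrow> C i \<in> sets borel\<close> by (auto simp: A_def B_def)
    have C: "Pi\<^sub>E ?K C \<in> sets ?P"
      using \<open>\<And>i. i \<in> ?K \<Longrightarrow> C i \<in> sets borel\<close> by (intro sets_PiM_I_finite) auto
    have ball_K: "(\<forall>i\<in>?K. Q i) \<longleftrightarrow> (\<forall>k<2 ^ n. Q (k, True) \<and> Q (k, False))" for Q
      by (auto simp: all_bool_eq)
    have "V \<omega> \<in> Pi\<^sub>E ?K C \<longleftrightarrow> (\<forall>i\<in>?K. V \<omega> i \<in> C i)" for \<omega>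
      by (auto simp: V_def PiE_iff)
    then have V_C: "V -` Pi\<^sub>E ?K C \<inter> space M =
        {\<omega> \<in> space M. \<forall>k<2 ^ n. incr n k \<omega> \<in> A k \<and> incr (Suc n) (2 * k) \<omega> \<in> B k}"
      unfolding ball_K by (auto simp: V_def A_def B_def)
    have "V' z \<in> Pi\<^sub>E ?K C \<longleftrightarrow> (\<forall>i\<in>?K. V' z i \<in> C i)" for z
      by (auto simp: V'_def PiE_iff)
    then have V'_C: "V' -` Pi\<^sub>E ?K C \<inter> space N = Pi\<^sub>E ?I (\<lambda>k. {(u, v). u \<in> B k \<and> u + v \<in> A k})"
      unfolding ball_K case_prod_unfold
      by (auto simp: V'_def A_def B_def N_def space_PiM space_pair_measure PiE_iff)
    have "emeasure (distr M ?P V) (Pi\<^sub>E ?K C) =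
        (\<Prod>k<2 ^ n. emeasure (law h \<Otimes>\<^sub>M law h) {(u, v). u \<in> B k \<and> u + v \<in> A k})"
      unfolding h_def by (subst emeasure_distr[OF _ C], measurable, subst V_C, rule rectangle_prob[OF _ _ Suc]) measurable
    also have "\<dots> = emeasure N (Pi\<^sub>E ?I (\<lambda>k. {(u, v). u \<in> B k \<and> u + v \<in> A k}))"
      unfolding N_def using sets_fst_and_sum
      by (intro P2.emeasure_PiM[symmetric]) (auto cong: sets_pair_measure_cong)
    also have "\<dots> = emeasure (distr N ?P V') (Pi\<^sub>E ?K C)"
      by (subst emeasure_distr[OF _ C]) (auto simp: V'_C)
    finally show "emeasure (distr M ?P V) (Pi\<^sub>E ?K C) = emeasure (distr N ?P V') (Pi\<^sub>E ?K C)" .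
  next
    show "range (\<lambda>_::nat. Pi\<^sub>E ?K (\<lambda>_. UNIV)) \<subseteq> prod_algebra ?K (\<lambda>_. borel :: real measure)"
      by (auto intro!: prod_algebraI_finite)
    show "emeasure (distr M ?P V) (Pi\<^sub>E ?K (\<lambda>_. UNIV)) \<noteq> \<infinity>" for i :: nat
      using prob_space.finite_measure[OF prob_space_distr[of V ?P]]
      by (simp add: finite_measure.emeasure_finite)
  qed (auto simp: space_PiM)
  have "distr M (PiM ?J (\<lambda>_. borel)) (\<lambda>\<omega>. \<lambda>k\<in>?J. incr (Suc n) k \<omega>) = distr M (PiM ?J (\<lambda>_. borel)) (\<lambda>\<omega>. W (V \<omega>))"
  proof (rule distr_cong)
    fix \<omega> assume \<omega>: "\<omega> \<in> space M"
    have "incr (Suc n) j \<omega> = incr n (j div 2) \<omega> - incr (Suc n) (2 * (j div 2)) \<omega>" if "j \<in> ?J" "odd j" for j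
    proof -
      have "j div 2 < 2 ^ n" using that by (auto simp: less_mult_imp_div_less)
      from incr_refine[OF this \<omega>] that show ?thesis by (simp add: odd_two_times_div_two_succ[simplified])
    qed
    then show "(\<lambda>k\<in>?J. incr (Suc n) k \<omega>) = W (V \<omega>)"
      by (auto simp: W_def V_def fun_eq_iff less_mult_imp_div_less)
  qed auto
  also have "\<dots> = distr (distr M ?P V) (PiM ?J (\<lambda>_. borel)) W"
    by (subst distr_distr) (auto simp: comp_def simp del: power_Suc)
  also have "\<dots> = distr N (PiM ?J (\<lambda>_. borel)) (\<lambda>z. W (V' z))"
    unfolding VV' by (subst distr_distr) (auto simp: comp_def simp del: power_Suc)
  also have "\<dots> = PiM ?J (\<lambda>_. law h)"
  proof (rule P1.PiM_eqI)
    show "sets (distr N (PiM ?J (\<lambda>_. borel)) (\<lambda>z. W (V' z))) = sets (PiM ?J (\<lambda>_. law h))"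
      by (auto cong: sets_PiM_cong)
    fix C :: "nat \<Rightarrow> real set" assume C: "\<And>j. j \<in> ?J \<Longrightarrow> C j \<in> sets (law h)"
    \<comment> \<open>For z k = (u, v) the even entry is u and the odd one is (u + v) - u = v, so
      \<open>W\<close> after \<open>V'\<close> merely lists the pairs one after another.\<close>
    have pre: "(\<lambda>z. W (V' z)) -` Pi\<^sub>E ?J C \<inter> space N = Pi\<^sub>E ?I (\<lambda>k. C (2 * k) \<times> C (2 * k + 1))"
    proof -
      have "W (V' z) \<in> Pi\<^sub>E ?J C \<longleftrightarrow> (\<forall>k<2 ^ n. z k \<in> C (2 * k) \<times> C (2 * k + 1))" for z
      proof -
        have J: "?J = (\<lambda>k. 2 * k) ` ?I \<union> (\<lambda>k. 2 * k + 1) ` ?I"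
        proof (intro set_eqI iffI)
          fix j assume "j \<in> ?J"
          then show "j \<in> (\<lambda>k. 2 * k) ` ?I \<union> (\<lambda>k. 2 * k + 1) ` ?I"
            by (cases "even j") (auto elim!: evenE oddE)
        qed auto
        have "W (V' z) \<in> Pi\<^sub>E ?J C \<longleftrightarrow> (\<forall>j\<in>?J. W (V' z) j \<in> C j)"
          by (auto simp: PiE_iff W_def)
        also have "\<dots> \<longleftrightarrow> (\<forall>k<2 ^ n. z k \<in> C (2 * k) \<times> C (2 * k + 1))"
          unfolding J W_def V'_def by (auto simp: ball_Un mem_Times_iff)
        finally show ?thesis .
      qed
      then show ?thesis
        by (auto simp: N_def space_PiM space_pair_measure PiE_iff extensional_def)
    qed
    have "Pi\<^sub>E ?J C \<in> sets (PiM ?J (\<lambda>_. borel))"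
      using C by (intro sets_PiM_I_finite) auto
    then have "emeasure (distr N (PiM ?J (\<lambda>_. borel)) (\<lambda>z. W (V' z))) (Pi\<^sub>E ?J C) = emeasure N (Pi\<^sub>E ?I (\<lambda>k. C (2 * k) \<times> C (2 * k + 1)))"
      by (subst emeasure_distr) (auto simp: pre simp del: power_Suc)
    also have "\<dots> = (\<Prod>k<2 ^ n. emeasure (law h \<Otimes>\<^sub>M law h) (C (2 * k) \<times> C (2 * k + 1)))"
      unfolding N_def using C by (intro P2.emeasure_PiM) auto
    also have "\<dots> = (\<Prod>k<2 ^ n. emeasure (law h) (C (2 * k)) * emeasure (law h) (C (2 * k + 1)))"
      using C by (intro prod.cong refl L.emeasure_pair_measure_Times) auto
    also have "\<dots> = (\<Prod>j\<in>?J. emeasure (law h) (C j))"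
      by (simp only: power_Suc prod_lessThan_pairs)
    finally show "emeasure (distr N (PiM ?J (\<lambda>_. borel)) (\<lambda>z. W (V' z))) (Pi\<^sub>E ?J C) = (\<Prod>j\<in>?J. emeasure (law h) (C j))" .
  qed simp
  finally show ?case unfolding h_def .
qed

lemma distr_incr_single: 
  assumes "j < 2 ^ n"
  shows "distr M borel (incr n j) = law (T / 2 ^ n)"
proof -
  have h: "T / 2 ^ n \<in> {0<..T} \<union> {1}" using T by (auto simp: field_simps)
  let ?P = "PiM {..<2 ^ n} (\<lambda>_. borel :: real measure)"
  have "law (T / 2 ^ n) = distr (PiM {..<2 ^ n} (\<lambda>_. law (T / 2 ^ n))) borel (\<lambda>y. y j)"
    using distr_PiM_component[of "{..<2 ^ n}" "\<lambda>_. law (T / 2 ^ n)" j] prob_space_law[OF h] assms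
    by (simp cong: distr_cong)
  also have "\<dots> = distr M borel (\<lambda>\<omega>. (\<lambda>k\<in>{..<2 ^ n}. incr n k \<omega>) j)"
    unfolding distr_incr[symmetric] using assms
    by (subst distr_distr) (auto simp: comp_def)
  finally show ?thesis using assms by simp
qed

lemma indep_incr: "indep_vars (\<lambda>_. borel) (incr n) {..<2 ^ n}"
  by (subst indep_vars_iff_distr_eq_PiM')
     (auto simp: distr_incr distr_incr_single lessThan_empty_iff intro!: PiM_cong)

end

subsection \<open>Limits in \<open>L\<^sup>1\<close> and \<open>L\<^sup>p\<close>\<close>

context prob_space
begin

lemma indep_vars_block_sum:
  fixes D :: "'i \<Rightarrow> 'a \<Rightarrow> real"
  assumes D: "indep_vars (\<lambda>_. borel) D I"
    and K: "\<And>j. j \<in> J \<Longrightarrow> K j \<subseteq> I" "disjoint_family_on K J"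
  shows "indep_vars (\<lambda>_. borel) (\<lambda>j \<omega>. \<Sum>i\<in>K j. D i \<omega>) J"
proof -
  have "indep_vars (\<lambda>_. borel) (\<lambda>j \<omega>. \<Sum>i\<in>K j. (\<lambda>i\<in>K j. D i \<omega>) i) J"
    by (rule indep_vars_compose2[OF indep_vars_restrict[OF D K]]) auto
  then show ?thesis by (simp cong: sum.cong_simp)
qed

lemma abs_powr_expectation_le:
  fixes Y :: "'a \<Rightarrow> real" and p :: real
  assumes "1 \<le> p" and Y: "integrable M Y"
  shows "ennreal (\<bar>expectation Y\<bar> powr p) \<le> (\<integral>\<^sup>+\<omega>. ennreal (\<bar>Y \<omega>\<bar> powr p) \<partial>M)"
proof (cases "(\<integral>\<^sup>+\<omega>. ennreal (\<bar>Y \<omega>\<bar> powr p) \<partial>M) = \<infinity>")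
  case False
  have [measurable]: "Y \<in> borel_measurable M" using Y by simp
  have int: "integrable M (\<lambda>\<omega>. \<bar>Y \<omega>\<bar> powr p)"
    using False by (intro integrableI_nonneg) (auto simp: less_top)
  have "\<bar>expectation Y\<bar> powr p \<le> expectation (\<lambda>\<omega>. \<bar>Y \<omega>\<bar> powr p)"
    using jensens_inequality[OF Y _ _ int convex_on_abs_powr[OF assms(1)]] by auto
  then show ?thesis by (subst nn_integral_eq_integral[OF int]) (auto intro: ennreal_leI)
qed simp

text \<open>For a fixed number a the mean of a + B - E B is a, so Jensen's inequality bounds |a|^p
  by the p-th moment of that variable. Integrating over the law of A is legitimate by independence,
  and the restriction to S survives because it concerns A alone.\<close>

lemma indep_centered_powr_le:
  fixes A B :: "'a \<Rightarrow> real" and p :: real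
  assumes p: "1 \<le> p" and ind: "indep_var borel A borel B" and B: "integrable M B"
    and S [measurable]: "S \<in> sets borel"
  shows "(\<integral>\<^sup>+\<omega>. ennreal (\<bar>A \<omega>\<bar> powr p) * indicator S (A \<omega>) \<partial>M) \<le>
    (\<integral>\<^sup>+\<omega>. ennreal (\<bar>A \<omega> + B \<omega> - expectation B\<bar> powr p) * indicator S (A \<omega>) \<partial>M)"
proof -
  let ?b = "expectation B"
  have [measurable]: "random_variable borel A" "random_variable borel B"
    using ind by (auto dest: indep_var_rv1 indep_var_rv2)
  have joint: "distr M borel A \<Otimes>\<^sub>M distr M borel B = distr M (borel \<Otimes>\<^sub>M borel) (\<lambda>x. (A x, B x))"
    using ind by (simp add: indep_var_distribution_eq)
  interpret DB: prob_space "distr M borel B" by (rule prob_space_distr) simp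
  have "(\<integral>\<^sup>+\<omega>. ennreal (\<bar>A \<omega>\<bar> powr p) * indicator S (A \<omega>) \<partial>M) =
      (\<integral>\<^sup>+a. ennreal (\<bar>a\<bar> powr p) * indicator S a \<partial>distr M borel A)"
    by (subst nn_integral_distr) auto
  also have "\<dots> \<le> (\<integral>\<^sup>+a. (\<integral>\<^sup>+b. ennreal (\<bar>a + b - ?b\<bar> powr p) * indicator S a \<partial>distr M borel B) \<partial>distr M borel A)"
  proof (rule nn_integral_mono)
    fix a
    have "ennreal (\<bar>a\<bar> powr p) \<le> (\<integral>\<^sup>+\<omega>. ennreal (\<bar>a + B \<omega> - ?b\<bar> powr p) \<partial>M)"
      using abs_powr_expectation_le[OF p, of "\<lambda>\<omega>. a + B \<omega> - ?b"] B by (simp add: prob_space)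
    also have "\<dots> = (\<integral>\<^sup>+b. ennreal (\<bar>a + b - ?b\<bar> powr p) \<partial>distr M borel B)"
      by (subst nn_integral_distr) auto
    finally show "ennreal (\<bar>a\<bar> powr p) * indicator S a \<le>
        (\<integral>\<^sup>+b. ennreal (\<bar>a + b - ?b\<bar> powr p) * indicator S a \<partial>distr M borel B)"
      by (auto split: split_indicator)
  qed
  also have "\<dots> = (\<integral>\<^sup>+z. ennreal (\<bar>fst z + snd z - ?b\<bar> powr p) * indicator S (fst z) \<partial>(distr M borel A \<Otimes>\<^sub>M distr M borel B))"
    by (subst DB.nn_integral_fst[symmetric]) auto
  also have "\<dots> = (\<integral>\<^sup>+\<omega>. ennreal (\<bar>A \<omega> + B \<omega> - ?b\<bar> powr p) * indicator S (A \<omega>) \<partial>M)"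
    unfolding joint by (subst nn_integral_distr) auto
  finally show ?thesis .
qed

text \<open>The values of G above a high level n contribute less than \<delta>/2 on any set; the
  values up to n contribute at most n times the probability of the set.\<close>

lemma nn_integral_absolutely_continuous:
  fixes G :: "'a \<Rightarrow> real"
  assumes G: "integrable M G" "\<And>\<omega>. 0 \<le> G \<omega>" and \<delta>: "0 < \<delta>"
  obtains \<theta> where "0 < \<theta>"
    and "\<And>A. A \<in> events \<Longrightarrow> prob A < \<theta> \<Longrightarrow> (\<integral>\<^sup>+\<omega>. ennreal (G \<omega>) * indicator A \<omega> \<partial>M) \<le> ennreal \<delta>"
proof -
  have [measurable]: "G \<in> borel_measurable M" using G by simp
  have "(\<lambda>n. \<integral>\<omega>. G \<omega> * indicator {\<omega>. real n < G \<omega>} \<omega> \<partial>M) \<longlonglongrightarrow> (\<integral>\<omega>. 0 \<partial>M)"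
  proof (rule integral_dominated_convergence[where w = G])
    show "AE \<omega> in M. (\<lambda>n. G \<omega> * indicator {\<omega>. real n < G \<omega>} \<omega>) \<longlonglongrightarrow> 0"
    proof (rule AE_I2)
      fix \<omega>
      obtain N :: nat where "G \<omega> \<le> real N" using real_arch_simple by blast
      then have "\<forall>\<^sub>F n in sequentially. G \<omega> * indicator {\<omega>. real n < G \<omega>} \<omega> = 0"
        by (intro eventually_sequentiallyI[of N]) (auto simp: indicator_def)
      then show "(\<lambda>n. G \<omega> * indicator {\<omega>. real n < G \<omega>} \<omega>) \<longlonglongrightarrow> 0" by (rule tendsto_eventually)
    qed
  qed (use G in \<open>auto split: split_indicator\<close>)
  then have "\<forall>\<^sub>F n in sequentially. (\<integral>\<omega>. G \<omega> * indicator {\<omega>. real n < G \<omega>} \<omega> \<partial>M) < \<delta> / 2"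
    using \<delta> by (intro order_tendstoD) auto
  then obtain n :: nat where n: "(\<integral>\<omega>. G \<omega> * indicator {\<omega>. real n < G \<omega>} \<omega> \<partial>M) < \<delta> / 2"
    by (auto simp: eventually_sequentially)
  have int: "integrable M (\<lambda>\<omega>. G \<omega> * indicator {\<omega>. real n < G \<omega>} \<omega>)"
    by (rule Bochner_Integration.integrable_bound[OF G(1)]) (use G in \<open>auto split: split_indicator\<close>)
  \<comment> \<open>The summand 1 keeps the denominator positive for n = 0.\<close>
  show thesis
  proof (rule that[of "\<delta> / (2 * (real n + 1))"])
    fix A assume [measurable]: "A \<in> events" and A: "prob A < \<delta> / (2 * (real n + 1))"
    have "(\<integral>\<^sup>+\<omega>. ennreal (G \<omega>) * indicator A \<omega> \<partial>M) \<le>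
        (\<integral>\<^sup>+\<omega>. ennreal (G \<omega> * indicator {\<omega>. real n < G \<omega>} \<omega>) + ennreal (real n) * indicator A \<omega> \<partial>M)"
      using G by (intro nn_integral_mono) (auto split: split_indicator simp flip: ennreal_plus intro!: ennreal_leI)
    also have "\<dots> = ennreal (\<integral>\<omega>. G \<omega> * indicator {\<omega>. real n < G \<omega>} \<omega> \<partial>M) + ennreal (real n) * ennreal (prob A)"
      using G by (simp add: nn_integral_add nn_integral_cmult_indicator emeasure_eq_measure nn_integral_eq_integral[OF int])
    also have "\<dots> \<le> ennreal (\<delta> / 2 + real n * prob A)"
      using n \<delta> by (simp add: ennreal_mult add_mono ennreal_leI)
    also have "\<dots> \<le> ennreal \<delta>"
    proof (rule ennreal_leI)
      have "real n * prob A \<le> (real n + 1) * (\<delta> / (2 * (real n + 1)))"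
        using A by (intro mult_mono) auto
      also have "\<dots> = \<delta> / 2" by (simp add: field_simps)
      finally show "\<delta> / 2 + real n * prob A \<le> \<delta>" by simp
    qed
    finally show "(\<integral>\<^sup>+\<omega>. ennreal (G \<omega>) * indicator A \<omega> \<partial>M) \<le> ennreal \<delta>" .
  qed (use \<delta> in simp)
qed

text \<open>Where |z| > \<epsilon>, the factor \<open>\<bar>z\<bar> powr (1 - p)\<close> is at most
  \<open>\<epsilon> powr (1 - p)\<close>, as the exponent is not positive. The parameter stays free:
  it is chosen small to transfer convergence, and \<epsilon> = 1 gives integrability from a finite
  p-th moment.\<close>

lemma L1_le_Lp:
  fixes Z :: "'a \<Rightarrow> real" and p :: real
  assumes "1 \<le> p" "0 < \<epsilon>" and [measurable]: "Z \<in> borel_measurable M"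
  shows "(\<integral>\<^sup>+\<omega>. ennreal \<bar>Z \<omega>\<bar> \<partial>M) \<le>
    ennreal \<epsilon> + ennreal (\<epsilon> powr (1 - p)) * (\<integral>\<^sup>+\<omega>. ennreal (\<bar>Z \<omega>\<bar> powr p) \<partial>M)"
proof -
  have *: "\<bar>z\<bar> \<le> \<epsilon> + \<epsilon> powr (1 - p) * \<bar>z\<bar> powr p" for z :: real
  proof (cases "\<bar>z\<bar> \<le> \<epsilon>")
    case False
    then have "\<bar>z\<bar> = \<bar>z\<bar> powr (1 - p) * \<bar>z\<bar> powr p" using assms by (simp flip: powr_add)
    also have "\<dots> \<le> \<epsilon> powr (1 - p) * \<bar>z\<bar> powr p"
      using False assms by (intro mult_right_mono powr_mono2') auto
    finally show ?thesis using assms by simp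
  qed (use assms in \<open>auto intro: add_increasing2\<close>)
  have "(\<integral>\<^sup>+\<omega>. ennreal \<bar>Z \<omega>\<bar> \<partial>M) \<le>
      (\<integral>\<^sup>+\<omega>. ennreal \<epsilon> + ennreal (\<epsilon> powr (1 - p)) * ennreal (\<bar>Z \<omega>\<bar> powr p) \<partial>M)"
    using * assms by (intro nn_integral_mono) (simp flip: ennreal_plus ennreal_mult)
  also have "\<dots> = ennreal \<epsilon> + ennreal (\<epsilon> powr (1 - p)) * (\<integral>\<^sup>+\<omega>. ennreal (\<bar>Z \<omega>\<bar> powr p) \<partial>M)"
    by (simp add: nn_integral_add nn_integral_cmult emeasure_space_1)
  finally show ?thesis .
qed


text \<open>The map sending x to \<open>iexp (u * x)\<close> is Lipschitz with constant |u|, so L^1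
  convergence passes to the exponentials and hence to their expectations.\<close>

lemma char_tendsto_L1:
  fixes Z :: "nat \<Rightarrow> 'a \<Rightarrow> real"
  assumes [measurable]: "\<And>n. Z n \<in> borel_measurable M" "Y \<in> borel_measurable M"
    and lim: "(\<lambda>n. \<integral>\<^sup>+\<omega>. ennreal \<bar>Z n \<omega> - Y \<omega>\<bar> \<partial>M) \<longlonglongrightarrow> 0"
  shows "(\<lambda>n. char (distr M borel (Z n)) u) \<longlonglongrightarrow> char (distr M borel Y) u"
proof -
  have *: "cmod (iexp (u * x) - iexp (u * y)) \<le> \<bar>u\<bar> * \<bar>x - y\<bar>" for x y :: real
  proof -
    have "iexp (u * x) - iexp (u * y) = iexp (u * y) * (iexp (u * (x - y)) - 1)"
      by (simp add: ring_distribs exp_add[symmetric] flip: exp_add)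
    then have "cmod (iexp (u * x) - iexp (u * y)) = cmod (iexp (u * (x - y)) - 1)"
      by (simp add: norm_mult del: of_real_mult)
    also have "\<dots> \<le> \<bar>u * (x - y)\<bar>" using iexp_approx1[of "u * (x - y)" 0] by simp
    finally show ?thesis by (simp add: abs_mult)
  qed
  have "(\<lambda>n. CLINT \<omega>|M. iexp (u * Z n \<omega>)) \<longlonglongrightarrow> (CLINT \<omega>|M. iexp (u * Y \<omega>))"
  proof (rule tendsto_L1_int)
    show "integrable M (\<lambda>\<omega>. iexp (u * Z n \<omega>))" "integrable M (\<lambda>\<omega>. iexp (u * Y \<omega>))" for n
      by (intro integrable_const_bound[of _ 1]; simp)+
    have "(\<lambda>n. ennreal \<bar>u\<bar> * (\<integral>\<^sup>+\<omega>. ennreal \<bar>Z n \<omega> - Y \<omega>\<bar> \<partial>M)) \<longlonglongrightarrow> ennreal \<bar>u\<bar> * 0"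
      by (intro ennreal_tendsto_cmult lim) auto
    then have l: "(\<lambda>n. \<integral>\<^sup>+\<omega>. ennreal (\<bar>u\<bar> * \<bar>Z n \<omega> - Y \<omega>\<bar>) \<partial>M) \<longlonglongrightarrow> 0"
      by (simp add: ennreal_mult nn_integral_cmult)
    show "(\<lambda>n. \<integral>\<^sup>+\<omega>. ennreal (cmod (iexp (u * Z n \<omega>) - iexp (u * Y \<omega>))) \<partial>M) \<longlonglongrightarrow> 0"
      by (rule tendsto_sandwich[OF _ _ tendsto_const l])
         (intro always_eventually allI zero_le, intro always_eventually allI nn_integral_mono ennreal_leI *)
  qed
  then show ?thesis
    unfolding char_def by (simp add: integral_distr)
qed

text \<open>It suffices to factor the probabilities of closed sets, whose indicators are decreasing limits
  of the Lipschitz functions \<open>g m\<close> below.\<close>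

lemma indep_vars_L1_limit:
  fixes Z :: "nat \<Rightarrow> 'i \<Rightarrow> 'a \<Rightarrow> real"
  assumes I: "finite I" and ind: "\<And>n. indep_vars (\<lambda>_. borel) (Z n) I"
    and Ym: "\<And>i. i \<in> I \<Longrightarrow> Y i \<in> borel_measurable M"
    and lim: "\<And>i. i \<in> I \<Longrightarrow> (\<lambda>n. \<integral>\<^sup>+\<omega>. ennreal \<bar>Z n i \<omega> - Y i \<omega>\<bar> \<partial>M) \<longlonglongrightarrow> 0"
  shows "indep_vars (\<lambda>_. borel) Y I"
proof (cases "I = {}")
  case True
  then show ?thesis by (simp add: indep_vars_def indep_sets_def)
next
  case False
  note [measurable] = Ym
  have Zm [measurable]: "i \<in> I \<Longrightarrow> Z n i \<in> borel_measurable M" for n i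
    using ind[of n] by (auto simp: indep_vars_def)
  have key: "prob (\<Inter>i\<in>I. Y i -` C i \<inter> space M) = (\<Prod>i\<in>I. prob (Y i -` C i \<inter> space M))"
    if C: "\<And>i. i \<in> I \<Longrightarrow> closed (C i)" for C
  proof (cases "\<exists>i\<in>I. C i = {}")
    \<comment> \<open>The distance to the empty set is 0 by convention, so \<open>g\<close> below
      would be constantly 1 instead of tending to the indicator 0; this case is settled
      directly.\<close>
    case True
    then obtain i where i: "i \<in> I" "C i = {}" by auto
    then have "(\<Inter>i\<in>I. Y i -` C i \<inter> space M) = {}" by force
    moreover have "(\<Prod>i\<in>I. prob (Y i -` C i \<inter> space M)) = 0"
      using i I by (intro prod_zero bexI[of _ i]) auto
    ultimately show ?thesis by simp
  next
    case ne: False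
    define g :: "nat \<Rightarrow> 'i \<Rightarrow> real \<Rightarrow> real" where "g m i x = max 0 (1 - real m * infdist x (C i))" for m i x
    have g01: "0 \<le> g m i x" "g m i x \<le> 1" for m i x
      by (auto simp: g_def infdist_nonneg)
    have g_lip: "\<bar>g m i x - g m i y\<bar> \<le> real m * \<bar>x - y\<bar>" for m i x y
    proof -
      have "\<bar>g m i x - g m i y\<bar> \<le> \<bar>real m * infdist x (C i) - real m * infdist y (C i)\<bar>"
        unfolding g_def by linarith
      also have "\<dots> = real m * \<bar>infdist x (C i) - infdist y (C i)\<bar>"
        by (simp add: abs_mult flip: right_diff_distrib)
      also have "\<dots> \<le> real m * \<bar>x - y\<bar>"
        using infdist_triangle_abs[of x "C i" y] by (intro mult_left_mono) (auto simp: dist_real_def)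
      finally show ?thesis .
    qed
    have [measurable]: "g m i \<in> borel_measurable borel" for m i
      unfolding g_def[abs_def] by (intro borel_measurable_continuous_onI continuous_intros)
    have g_lim: "(\<lambda>m. g m i x) \<longlonglongrightarrow> indicator (C i) x" if "i \<in> I" for i x
    proof (cases "x \<in> C i")
      case True
      then show ?thesis by (simp add: g_def)
    next
      case False
      then have "0 < infdist x (C i)"
        using in_closed_iff_infdist_zero[OF C[OF that], of x] ne that infdist_nonneg[of x "C i"] by auto
      then obtain N :: nat where N: "1 < real N * infdist x (C i)"
        using reals_Archimedean3 by blast
      have "g m i x = 0" if "N \<le> m" for m
      proof -
        have "real N * infdist x (C i) \<le> real m * infdist x (C i)"
          using that by (intro mult_right_mono infdist_nonneg) auto
        then show ?thesis using N by (simp add: g_def)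
      qed
      then have "\<forall>\<^sub>F m in sequentially. g m i x = 0" by (auto simp: eventually_sequentially)
      then show ?thesis using False by (simp add: tendsto_eventually)
    qed
    have gY_int: "integrable M (\<lambda>\<omega>. g m i (Y i \<omega>))" if "i \<in> I" for m i
      using g01 that by (intro integrable_const_bound[of _ 1]) auto
    have gZ_int: "integrable M (\<lambda>\<omega>. g m i (Z n i \<omega>))" if "i \<in> I" for m n i
      using g01 that by (intro integrable_const_bound[of _ 1]) auto
    have prod_norm: "\<bar>\<Prod>i\<in>I. g m i (W i)\<bar> \<le> 1" for m W
      using g01 by (auto simp: abs_prod intro!: prod_le_1)
    \<comment> \<open>Two limits are taken in succession: here n tends to infinity with m fixed,
      where the \<open>g m i\<close> are bounded and Lipschitz so that their products converge in
      L^1; afterwards m tends to infinity by dominated convergence.\<close>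
    have fac: "expectation (\<lambda>\<omega>. \<Prod>i\<in>I. g m i (Y i \<omega>)) = (\<Prod>i\<in>I. expectation (\<lambda>\<omega>. g m i (Y i \<omega>)))" for m
    proof (rule LIMSEQ_unique)
      have d: "(\<lambda>n. \<Sum>i\<in>I. \<integral>\<^sup>+\<omega>. ennreal (norm (g m i (Z n i \<omega>) - g m i (Y i \<omega>))) \<partial>M) \<longlonglongrightarrow> 0"
        and d1: "\<And>i. i \<in> I \<Longrightarrow> (\<lambda>n. \<integral>\<^sup>+\<omega>. ennreal (norm (g m i (Z n i \<omega>) - g m i (Y i \<omega>))) \<partial>M) \<longlonglongrightarrow> 0"
      proof -
        show d1: "(\<lambda>n. \<integral>\<^sup>+\<omega>. ennreal (norm (g m i (Z n i \<omega>) - g m i (Y i \<omega>))) \<partial>M) \<longlonglongrightarrow> 0" if "i \<in> I" for i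
        proof -
          have "(\<lambda>n. ennreal (real m) * (\<integral>\<^sup>+\<omega>. ennreal \<bar>Z n i \<omega> - Y i \<omega>\<bar> \<partial>M)) \<longlonglongrightarrow> ennreal (real m) * 0"
            by (intro ennreal_tendsto_cmult lim that) auto
          then have l: "(\<lambda>n. \<integral>\<^sup>+\<omega>. ennreal (real m * \<bar>Z n i \<omega> - Y i \<omega>\<bar>) \<partial>M) \<longlonglongrightarrow> 0"
            using that by (simp add: ennreal_mult nn_integral_cmult)
          show ?thesis
            by (rule tendsto_sandwich[OF _ _ tendsto_const l])
               (auto intro!: always_eventually nn_integral_mono ennreal_leI g_lip)
        qed
        show "(\<lambda>n. \<Sum>i\<in>I. \<integral>\<^sup>+\<omega>. ennreal (norm (g m i (Z n i \<omega>) - g m i (Y i \<omega>))) \<partial>M) \<longlonglongrightarrow> 0"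
          using tendsto_sum[of I, OF d1] by simp
      qed
      show "(\<lambda>n. expectation (\<lambda>\<omega>. \<Prod>i\<in>I. g m i (Z n i \<omega>))) \<longlonglongrightarrow> expectation (\<lambda>\<omega>. \<Prod>i\<in>I. g m i (Y i \<omega>))"
      proof (rule tendsto_L1_int)
        show "integrable M (\<lambda>\<omega>. \<Prod>i\<in>I. g m i (Z n i \<omega>))" "integrable M (\<lambda>\<omega>. \<Prod>i\<in>I. g m i (Y i \<omega>))" for n
          using prod_norm by (intro integrable_const_bound[of _ 1]; simp)+
        have "norm ((\<Prod>i\<in>I. g m i (x i)) - (\<Prod>i\<in>I. g m i (y i))) \<le> (\<Sum>i\<in>I. norm (g m i (x i) - g m i (y i)))" for x y
          using g01 by (intro norm_prod_diff) auto
        then have "(\<integral>\<^sup>+\<omega>. ennreal (norm ((\<Prod>i\<in>I. g m i (Z n i \<omega>)) - (\<Prod>i\<in>I. g m i (Y i \<omega>)))) \<partial>M) \<le>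
            (\<Sum>i\<in>I. \<integral>\<^sup>+\<omega>. ennreal (norm (g m i (Z n i \<omega>) - g m i (Y i \<omega>))) \<partial>M)" for n
          by (subst nn_integral_sum[symmetric]) (auto intro!: nn_integral_mono ennreal_leI)
        then show "(\<lambda>n. \<integral>\<^sup>+\<omega>. ennreal (norm ((\<Prod>i\<in>I. g m i (Z n i \<omega>)) - (\<Prod>i\<in>I. g m i (Y i \<omega>)))) \<partial>M) \<longlonglongrightarrow> 0"
          by (intro tendsto_sandwich[OF _ _ tendsto_const d]) (auto intro!: always_eventually)
      qed
      have "expectation (\<lambda>\<omega>. \<Prod>i\<in>I. g m i (Z n i \<omega>)) = (\<Prod>i\<in>I. expectation (\<lambda>\<omega>. g m i (Z n i \<omega>)))" for n
        by (intro indep_vars_lebesgue_integral I gZ_int indep_vars_compose2[OF ind]) auto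
      moreover have "(\<lambda>n. \<Prod>i\<in>I. expectation (\<lambda>\<omega>. g m i (Z n i \<omega>))) \<longlonglongrightarrow> (\<Prod>i\<in>I. expectation (\<lambda>\<omega>. g m i (Y i \<omega>)))"
        by (intro tendsto_prod tendsto_L1_int gZ_int gY_int d1)
      ultimately show "(\<lambda>n. expectation (\<lambda>\<omega>. \<Prod>i\<in>I. g m i (Z n i \<omega>))) \<longlonglongrightarrow> (\<Prod>i\<in>I. expectation (\<lambda>\<omega>. g m i (Y i \<omega>)))"
        by simp
    qed
    have Cb [measurable]: "i \<in> I \<Longrightarrow> C i \<in> sets borel" for i using C by auto
    have "(\<Prod>i\<in>I. indicator (C i) (Y i \<omega>) :: real) = indicator (\<Inter>i\<in>I. Y i -` C i \<inter> space M) \<omega>" if "\<omega> \<in> space M" for \<omega>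
      using that I by (auto simp: indicator_def intro!: prod.neutral prod_zero)
    then have "expectation (\<lambda>\<omega>. \<Prod>i\<in>I. indicat_real (C i) (Y i \<omega>)) = expectation (indicat_real (\<Inter>i\<in>I. Y i -` C i \<inter> space M))"
      by (rule Bochner_Integration.integral_cong[OF refl])
    also have "\<dots> = prob ((\<Inter>i\<in>I. Y i -` C i \<inter> space M) \<inter> space M)" by simp
    also have "(\<Inter>i\<in>I. Y i -` C i \<inter> space M) \<inter> space M = (\<Inter>i\<in>I. Y i -` C i \<inter> space M)"
      using False by auto
    finally have "expectation (\<lambda>\<omega>. \<Prod>i\<in>I. indicat_real (C i) (Y i \<omega>)) = prob (\<Inter>i\<in>I. Y i -` C i \<inter> space M)" .
    moreover have "(\<lambda>m. expectation (\<lambda>\<omega>. \<Prod>i\<in>I. g m i (Y i \<omega>))) \<longlonglongrightarrow> expectation (\<lambda>\<omega>. \<Prod>i\<in>I. indicator (C i) (Y i \<omega>))"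
      using prod_norm g_lim
      by (intro integral_dominated_convergence[where w = "\<lambda>_. 1"]) (auto intro!: tendsto_prod)
    ultimately have l1: "(\<lambda>m. expectation (\<lambda>\<omega>. \<Prod>i\<in>I. g m i (Y i \<omega>))) \<longlonglongrightarrow> prob (\<Inter>i\<in>I. Y i -` C i \<inter> space M)"
      by simp
    have "(\<lambda>m. expectation (\<lambda>\<omega>. g m i (Y i \<omega>))) \<longlonglongrightarrow> prob (Y i -` C i \<inter> space M)" if i: "i \<in> I" for i
    proof -
      have "(\<lambda>m. expectation (\<lambda>\<omega>. g m i (Y i \<omega>))) \<longlonglongrightarrow> expectation (\<lambda>\<omega>. indicator (C i) (Y i \<omega>))"
        using g01 g_lim i
        by (intro integral_dominated_convergence[where w = "\<lambda>_. 1"]) auto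
      also have "expectation (\<lambda>\<omega>. indicator (C i) (Y i \<omega>)) = expectation (indicat_real (Y i -` C i \<inter> space M))"
        by (intro Bochner_Integration.integral_cong) (auto simp: indicator_def)
      finally show ?thesis using i by simp
    qed
    then have "(\<lambda>m. \<Prod>i\<in>I. expectation (\<lambda>\<omega>. g m i (Y i \<omega>))) \<longlonglongrightarrow> (\<Prod>i\<in>I. prob (Y i -` C i \<inter> space M))"
      by (intro tendsto_prod)
    with l1 show ?thesis unfolding fac by (rule LIMSEQ_unique)
  qed
  have borel: "sets (borel :: real measure) = sigma_sets (space borel) (Collect closed)"
    by (subst borel_eq_closed) simp
  have "indep_vars (\<lambda>_. borel) Y I \<longleftrightarrow> (\<forall>C\<in>(\<Pi> i\<in>I. Collect closed).
      prob (\<Inter>i\<in>I. Y i -` C i \<inter> space M) = (\<Prod>i\<in>I. prob (Y i -` C i \<inter> space M)))"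
    by (rule indep_vars_finite[OF False I borel Ym]) (auto simp: Int_stable_def)
  then show ?thesis
    by (simp only:) (intro ballI key, auto simp: Pi_iff)
qed

end

section \<open>From L^p to L^1 convergence, and limits of L^p Cauchy sequences\<close>

lemma ennreal_pos_real_less:
  fixes a :: ennreal
  assumes "0 < a"
  obtains \<delta> :: real where "0 < \<delta>" "ennreal \<delta> < a"
proof (cases a)
  case (real r)
  then show ?thesis using that[of "r / 2"] assms by (simp add: ennreal_less_iff)
next
  case top
  then show ?thesis using that[of 1] by simp
qed

context prob_space
begin

lemma L1_tendsto_diff:
  fixes U V :: "nat \<Rightarrow> 'a \<Rightarrow> real"
  assumes [measurable]: "\<And>n. U n \<in> borel_measurable M" "\<And>n. V n \<in> borel_measurable M"
      "u \<in> borel_measurable M" "v \<in> borel_measurable M"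
    and U: "(\<lambda>n. \<integral>\<^sup>+\<omega>. ennreal \<bar>U n \<omega> - u \<omega>\<bar> \<partial>M) \<longlonglongrightarrow> 0"
    and V: "(\<lambda>n. \<integral>\<^sup>+\<omega>. ennreal \<bar>V n \<omega> - v \<omega>\<bar> \<partial>M) \<longlonglongrightarrow> 0"
  shows "(\<lambda>n. \<integral>\<^sup>+\<omega>. ennreal \<bar>(U n \<omega> - V n \<omega>) - (u \<omega> - v \<omega>)\<bar> \<partial>M) \<longlonglongrightarrow> 0"
proof -
  have l: "(\<lambda>n. (\<integral>\<^sup>+\<omega>. ennreal \<bar>U n \<omega> - u \<omega>\<bar> \<partial>M) + (\<integral>\<^sup>+\<omega>. ennreal \<bar>V n \<omega> - v \<omega>\<bar> \<partial>M)) \<longlonglongrightarrow> 0"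
    using tendsto_add[OF U V] by simp
  have "(\<integral>\<^sup>+\<omega>. ennreal \<bar>(U n \<omega> - V n \<omega>) - (u \<omega> - v \<omega>)\<bar> \<partial>M) \<le>
      (\<integral>\<^sup>+\<omega>. ennreal \<bar>U n \<omega> - u \<omega>\<bar> \<partial>M) + (\<integral>\<^sup>+\<omega>. ennreal \<bar>V n \<omega> - v \<omega>\<bar> \<partial>M)" for n
    by (subst nn_integral_add[symmetric])
       (auto intro!: nn_integral_mono ennreal_leI simp flip: ennreal_plus)
  then show ?thesis
    by (intro tendsto_sandwich[OF _ _ tendsto_const l]) auto
qed

text \<open>The threshold depends on \<delta> and p alone, so that one choice serves all pairs of
  members of a Cauchy sequence at once.\<close>

lemma L1_small_if_Lp_small:
  fixes p \<delta> :: real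
  assumes p: "1 \<le> p" and \<delta>: "0 < \<delta>"
  obtains \<delta>' where "0 < \<delta>'"
    and "\<And>Z :: 'a \<Rightarrow> real. Z \<in> borel_measurable M \<Longrightarrow> (\<integral>\<^sup>+\<omega>. ennreal (\<bar>Z \<omega>\<bar> powr p) \<partial>M) \<le> ennreal \<delta>' \<Longrightarrow>
          (\<integral>\<^sup>+\<omega>. ennreal \<bar>Z \<omega>\<bar> \<partial>M) \<le> ennreal \<delta>"
proof (rule that)
  define \<epsilon> where "\<epsilon> = \<delta> / 2"
  have \<epsilon>: "0 < \<epsilon>" using \<delta> by (simp add: \<epsilon>_def)
  \<comment> \<open>With this threshold the second term of \<open>L1_le_Lp\<close> is at most
    \<epsilon>, that is, the other half of \<delta>.\<close>
  show "0 < \<epsilon> powr (p - 1) * \<epsilon>" using \<epsilon> by simp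
  fix Z :: "'a \<Rightarrow> real"
  assume [measurable]: "Z \<in> borel_measurable M"
    and Z: "(\<integral>\<^sup>+\<omega>. ennreal (\<bar>Z \<omega>\<bar> powr p) \<partial>M) \<le> ennreal (\<epsilon> powr (p - 1) * \<epsilon>)"
  have "(\<integral>\<^sup>+\<omega>. ennreal \<bar>Z \<omega>\<bar> \<partial>M) \<le> ennreal \<epsilon> + ennreal (\<epsilon> powr (1 - p)) * (\<integral>\<^sup>+\<omega>. ennreal (\<bar>Z \<omega>\<bar> powr p) \<partial>M)"
    by (rule L1_le_Lp[OF p \<epsilon>]) simp
  also have "\<dots> \<le> ennreal \<epsilon> + ennreal (\<epsilon> powr (1 - p)) * ennreal (\<epsilon> powr (p - 1) * \<epsilon>)"
    using Z by (intro add_left_mono mult_left_mono) auto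
  also have "\<dots> = ennreal (\<epsilon> + \<epsilon> powr (1 - p) * (\<epsilon> powr (p - 1) * \<epsilon>))"
    using \<epsilon> by (simp flip: ennreal_plus ennreal_mult)
  also have "\<epsilon> powr (1 - p) * (\<epsilon> powr (p - 1) * \<epsilon>) = \<epsilon>"
    using \<epsilon> by (simp flip: powr_add mult.assoc)
  finally show "(\<integral>\<^sup>+\<omega>. ennreal \<bar>Z \<omega>\<bar> \<partial>M) \<le> ennreal \<delta>" by (simp add: \<epsilon>_def)
qed

lemma Lp_tendsto_imp_L1_tendsto:
  fixes Z :: "nat \<Rightarrow> 'a \<Rightarrow> real" and p :: real
  assumes p: "1 \<le> p" and [measurable]: "\<And>n. Z n \<in> borel_measurable M"
    and lim: "(\<lambda>n. \<integral>\<^sup>+\<omega>. ennreal (\<bar>Z n \<omega>\<bar> powr p) \<partial>M) \<longlonglongrightarrow> 0"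
  shows "(\<lambda>n. \<integral>\<^sup>+\<omega>. ennreal \<bar>Z n \<omega>\<bar> \<partial>M) \<longlonglongrightarrow> 0"
proof (rule order_tendstoI)
  fix a :: ennreal assume "0 < a"
  obtain \<delta> where \<delta>: "0 < \<delta>" "ennreal \<delta> < a"
    using \<open>0 < a\<close> by (rule ennreal_pos_real_less)
  obtain \<delta>' where \<delta>': "0 < \<delta>'"
    "\<And>Z :: 'a \<Rightarrow> real. Z \<in> borel_measurable M \<Longrightarrow> (\<integral>\<^sup>+\<omega>. ennreal (\<bar>Z \<omega>\<bar> powr p) \<partial>M) \<le> ennreal \<delta>' \<Longrightarrow>
      (\<integral>\<^sup>+\<omega>. ennreal \<bar>Z \<omega>\<bar> \<partial>M) \<le> ennreal \<delta>"
    using L1_small_if_Lp_small[OF p \<delta>(1)] by metis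
  have "\<forall>\<^sub>F n in sequentially. (\<integral>\<^sup>+\<omega>. ennreal (\<bar>Z n \<omega>\<bar> powr p) \<partial>M) < ennreal \<delta>'"
    using \<delta>' by (intro order_tendstoD[OF lim]) auto
  then show "\<forall>\<^sub>F n in sequentially. (\<integral>\<^sup>+\<omega>. ennreal \<bar>Z n \<omega>\<bar> \<partial>M) < a"
  proof eventually_elim
    case (elim n)
    then have "(\<integral>\<^sup>+\<omega>. ennreal \<bar>Z n \<omega>\<bar> \<partial>M) \<le> ennreal \<delta>" by (intro \<delta>'(2)) auto
    then show ?case using \<delta>(2) by simp
  qed
qed simp

text \<open>The limit is taken pointwise along a subsequence, so that it is measurable for every
  sub-\<open>\<sigma>\<close>-algebra for which the sequence is.\<close>

lemma Lp_Cauchy_limit: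
  fixes Y :: "nat \<Rightarrow> 'a \<Rightarrow> real" and p :: real
  assumes p: "1 \<le> p" and Ym [measurable]: "\<And>n. Y n \<in> borel_measurable M"
    and Cauchy: "\<And>\<delta>. 0 < \<delta> \<Longrightarrow> \<exists>N. \<forall>n\<ge>N. \<forall>m\<ge>n. (\<integral>\<^sup>+\<omega>. ennreal (\<bar>Y m \<omega> - Y n \<omega>\<bar> powr p) \<partial>M) \<le> ennreal \<delta>"
  obtains r :: "nat \<Rightarrow> nat"
  where "(\<lambda>n. \<integral>\<^sup>+\<omega>. ennreal (\<bar>Y n \<omega> - lim (\<lambda>k. Y (r k) \<omega>)\<bar> powr p) \<partial>M) \<longlonglongrightarrow> 0"
proof -
  have "\<exists>N. \<forall>n\<ge>N. \<forall>m\<ge>n. (\<integral>\<^sup>+\<omega>. ennreal \<bar>Y m \<omega> - Y n \<omega>\<bar> \<partial>M) \<le> ennreal ((1/2) ^ k)" for k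
  proof -
    obtain \<delta>' where \<delta>': "0 < \<delta>'"
      "\<And>Z :: 'a \<Rightarrow> real. Z \<in> borel_measurable M \<Longrightarrow> (\<integral>\<^sup>+\<omega>. ennreal (\<bar>Z \<omega>\<bar> powr p) \<partial>M) \<le> ennreal \<delta>' \<Longrightarrow>
        (\<integral>\<^sup>+\<omega>. ennreal \<bar>Z \<omega>\<bar> \<partial>M) \<le> ennreal ((1/2) ^ k)"
      using L1_small_if_Lp_small[OF p, of "(1/2) ^ k"] by (metis zero_less_divide_1_iff zero_less_numeral zero_less_power)
    obtain N where "\<forall>n\<ge>N. \<forall>m\<ge>n. (\<integral>\<^sup>+\<omega>. ennreal (\<bar>Y m \<omega> - Y n \<omega>\<bar> powr p) \<partial>M) \<le> ennreal \<delta>'"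
      using Cauchy[OF \<delta>'(1)] by blast
    then have "\<forall>n\<ge>N. \<forall>m\<ge>n. (\<integral>\<^sup>+\<omega>. ennreal \<bar>Y m \<omega> - Y n \<omega>\<bar> \<partial>M) \<le> ennreal ((1/2) ^ k)"
      by (auto intro!: \<delta>'(2))
    then show ?thesis by blast
  qed
  then obtain N where N: "\<And>k n m. N k \<le> n \<Longrightarrow> n \<le> m \<Longrightarrow> (\<integral>\<^sup>+\<omega>. ennreal \<bar>Y m \<omega> - Y n \<omega>\<bar> \<partial>M) \<le> ennreal ((1/2) ^ k)"
    by metis
  \<comment> \<open>The summand k makes \<open>r\<close> strictly increasing and the sum dominates
    \<open>N k\<close>. Consecutive members along \<open>r\<close> are thus within (1/2)^k in L^1,
    and the telescoping series converges absolutely almost everywhere.\<close>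
  define r where "r k = k + (\<Sum>i\<le>k. N i)" for k
  have r: "strict_mono r" by (rule strict_monoI_Suc) (simp add: r_def)
  have rN: "N k \<le> r k" for k
    using member_le_sum[of k "{..k}" N] by (simp add: r_def)
  have rmono: "r k \<le> r (Suc k)" for k using r by (simp add: strict_mono_less_eq)
  have "(\<integral>\<^sup>+\<omega>. (\<Sum>k. ennreal \<bar>Y (r (Suc k)) \<omega> - Y (r k) \<omega>\<bar>) \<partial>M) = (\<Sum>k. \<integral>\<^sup>+\<omega>. ennreal \<bar>Y (r (Suc k)) \<omega> - Y (r k) \<omega>\<bar> \<partial>M)"
    by (rule nn_integral_suminf) simp
  also have "\<dots> \<le> (\<Sum>k. ennreal ((1/2) ^ k))"
    using N[OF rN rmono] by (intro suminf_le) auto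
  also have "\<dots> = ennreal (\<Sum>k. (1/2) ^ k)"
    by (intro suminf_ennreal2) (auto intro: summable_geometric)
  also have "\<dots> < \<infinity>" by simp
  finally have "AE \<omega> in M. (\<Sum>k. ennreal \<bar>Y (r (Suc k)) \<omega> - Y (r k) \<omega>\<bar>) \<noteq> \<infinity>"
    by (intro nn_integral_PInf_AE) auto
  then have conv: "AE \<omega> in M. (\<lambda>k. Y (r k) \<omega>) \<longlonglongrightarrow> lim (\<lambda>k. Y (r k) \<omega>)"
  proof eventually_elim
    case (elim \<omega>)
    then have "summable (\<lambda>k. \<bar>Y (r (Suc k)) \<omega> - Y (r k) \<omega>\<bar>)"
      by (intro summable_suminf_not_top) auto
    then have "summable (\<lambda>k. Y (r (Suc k)) \<omega> - Y (r k) \<omega>)" by (rule summable_rabs_cancel)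
    then have "convergent (\<lambda>n. \<Sum>k<n. Y (r (Suc k)) \<omega> - Y (r k) \<omega>)" by (simp add: summable_iff_convergent)
    then have "convergent (\<lambda>n. Y (r n) \<omega> - Y (r 0) \<omega>)" by (simp only: sum_lessThan_telescope[of "\<lambda>k. Y (r k) \<omega>"])
    then have "convergent (\<lambda>n. Y (r n) \<omega>)" by (simp add: convergent_diff_const_right_iff)
    then show ?case by (simp add: convergent_LIMSEQ_iff)
  qed
  show thesis
  proof (rule that[of r], rule order_tendstoI)
    fix a :: ennreal assume "0 < a"
    obtain \<delta> where \<delta>: "0 < \<delta>" "ennreal \<delta> < a"
      using \<open>0 < a\<close> by (rule ennreal_pos_real_less)
    obtain N where N: "\<And>n m. N \<le> n \<Longrightarrow> n \<le> m \<Longrightarrow> (\<integral>\<^sup>+\<omega>. ennreal (\<bar>Y m \<omega> - Y n \<omega>\<bar> powr p) \<partial>M) \<le> ennreal \<delta>"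
      using Cauchy[OF \<delta>(1)] by blast
    have "(\<integral>\<^sup>+\<omega>. ennreal (\<bar>Y n \<omega> - lim (\<lambda>k. Y (r k) \<omega>)\<bar> powr p) \<partial>M) < a" if n: "N \<le> n" for n
    proof -
      have "(\<integral>\<^sup>+\<omega>. ennreal (\<bar>Y n \<omega> - lim (\<lambda>k. Y (r k) \<omega>)\<bar> powr p) \<partial>M) =
          (\<integral>\<^sup>+\<omega>. liminf (\<lambda>k. ennreal (\<bar>Y n \<omega> - Y (r k) \<omega>\<bar> powr p)) \<partial>M)"
      proof (rule nn_integral_cong_AE)
        show "AE \<omega> in M. ennreal (\<bar>Y n \<omega> - lim (\<lambda>k. Y (r k) \<omega>)\<bar> powr p) =
            liminf (\<lambda>k. ennreal (\<bar>Y n \<omega> - Y (r k) \<omega>\<bar> powr p))"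
          using conv
        proof eventually_elim
          case (elim \<omega>)
          have "(\<lambda>k. ennreal (\<bar>Y n \<omega> - Y (r k) \<omega>\<bar> powr p)) \<longlonglongrightarrow> ennreal (\<bar>Y n \<omega> - lim (\<lambda>k. Y (r k) \<omega>)\<bar> powr p)"
            using p elim by (intro tendsto_intros tendsto_ennrealI tendsto_powr') auto
          then show ?case by (rule lim_imp_Liminf[OF sequentially_bot, symmetric])
        qed
      qed
      \<comment> \<open>Fatou's lemma: the distance of \<open>Y n\<close> to the limit inherits the
        Cauchy bound between \<open>Y n\<close> and later members.\<close>
      also have "\<dots> \<le> liminf (\<lambda>k. \<integral>\<^sup>+\<omega>. ennreal (\<bar>Y n \<omega> - Y (r k) \<omega>\<bar> powr p) \<partial>M)"
        by (rule nn_integral_liminf) simp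
      also have "\<dots> \<le> ennreal \<delta>"
      proof (rule Liminf_le)
        have "(\<integral>\<^sup>+\<omega>. ennreal (\<bar>Y n \<omega> - Y (r k) \<omega>\<bar> powr p) \<partial>M) \<le> ennreal \<delta>" if "n \<le> k" for k
          using N[OF n, of "r k"] that seq_suble[OF r, of k] by (simp add: abs_minus_commute)
        then show "\<forall>\<^sub>F k in sequentially. (\<integral>\<^sup>+\<omega>. ennreal (\<bar>Y n \<omega> - Y (r k) \<omega>\<bar> powr p) \<partial>M) \<le> ennreal \<delta>"
          by (auto simp: eventually_sequentially)
      qed simp
      finally show ?thesis using \<delta>(2) by simp
    qed
    then show "\<forall>\<^sub>F n in sequentially. (\<integral>\<^sup>+\<omega>. ennreal (\<bar>Y n \<omega> - lim (\<lambda>k. Y (r k) \<omega>)\<bar> powr p) \<partial>M) < a"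
      by (auto simp: eventually_sequentially)
  qed simp
qed

end

subsection \<open>Moments of increments over short times\<close>

context bridge_setup
begin

lemma X_diff: "\<lbrakk>a \<le> b; b \<le> 2 ^ n\<rbrakk> \<Longrightarrow> X n b \<omega> - X n a \<omega> = (\<Sum>j\<in>{a..<b}. incr n j \<omega>)"
  unfolding incr_def by (rule sum_Suc_diff'[symmetric])

lemma char_X_diff:
  assumes "a \<le> b" "b \<le> 2 ^ n"
  shows "char (distr M borel (\<lambda>\<omega>. X n b \<omega> - X n a \<omega>)) u = exp (of_real (real (b - a) * T / 2 ^ n) * \<psi> u)"
proof -
  have h: "T / 2 ^ n \<in> {0<..T} \<union> {1}" using T one_le_power[of "2::real" n] by (auto simp: field_simps simp del: one_le_power)
  have "char (distr M borel (\<lambda>\<omega>. X n b \<omega> - X n a \<omega>)) u = (\<Prod>j\<in>{a..<b}. char (distr M borel (incr n j)) u)"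
    unfolding X_diff[OF assms] using assms
    by (intro char_distr_sum indep_vars_subset[OF indep_incr]) auto
  also have "\<dots> = (\<Prod>j\<in>{a..<b}. exp (of_real (T / 2 ^ n) * \<psi> u))"
    using assms by (intro prod.cong refl) (simp add: distr_incr_single char_law[OF h])
  also have "\<dots> = exp (of_real (real (b - a) * T / 2 ^ n) * \<psi> u)"
    by (simp add: mult.assoc flip: exp_of_nat_mult)
  finally show ?thesis .
qed

lemma X_last: "\<omega> \<in> space M \<Longrightarrow> X n (2 ^ n) \<omega> = X 0 1 \<omega>"
  using X_refine_iter[of 1 0 \<omega> n] by simp

lemma incr_moment:
  assumes "j < 2 ^ n"
  shows "(\<integral>\<^sup>+\<omega>. ennreal (\<bar>incr n j \<omega>\<bar> powr p) \<partial>M) < \<infinity>"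
proof -
  have "(\<integral>\<^sup>+\<omega>. ennreal (\<bar>incr n j \<omega>\<bar> powr p) \<partial>M) = (\<integral>\<^sup>+x. ennreal (\<bar>x\<bar> powr p) \<partial>distr M borel (incr n j))"
    using assms by (subst nn_integral_distr) auto
  also have "\<dots> < \<infinity>"
    using law_moment[of "T / 2 ^ n"] assms T one_le_power[of "2::real" n]
    by (simp add: distr_incr_single field_simps del: one_le_power)
  finally show ?thesis .
qed

lemma incr_integrable:
  assumes "j < 2 ^ n"
  shows "integrable M (incr n j)"
proof (rule integrableI_bounded)
  have "(\<integral>\<^sup>+\<omega>. ennreal \<bar>incr n j \<omega>\<bar> \<partial>M) \<le>
      ennreal 1 + ennreal (1 powr (1 - p)) * (\<integral>\<^sup>+\<omega>. ennreal (\<bar>incr n j \<omega>\<bar> powr p) \<partial>M)"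
    using assms by (intro L1_le_Lp p) auto
  also have "\<dots> < \<infinity>" using incr_moment[OF assms] by (simp add: ennreal_mult_less_top)
  finally show "(\<integral>\<^sup>+\<omega>. ennreal (norm (incr n j \<omega>)) \<partial>M) < \<infinity>" by simp
qed (use assms in simp)

lemma X_last_moment: "(\<integral>\<^sup>+\<omega>. ennreal (\<bar>X 0 1 \<omega>\<bar> powr p) \<partial>M) < \<infinity>"
proof -
  have "(\<integral>\<^sup>+\<omega>. ennreal (\<bar>X 0 1 \<omega>\<bar> powr p) \<partial>M) = (\<integral>\<^sup>+\<omega>. ennreal (\<bar>incr 0 0 \<omega>\<bar> powr p) \<partial>M)"
    by (intro nn_integral_cong) (simp add: incr_def X_0)
  then show ?thesis using incr_moment[of 0 0] by simp
qed

text \<open>Identically distributed increments share the mean of the terminal value equally. Any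
  subfamily of them therefore has a mean of absolute value at most that of the terminal value, which
  bounds the centring constant uniformly in the level.\<close>

lemma expectation_incr:
  assumes "j < 2 ^ n"
  shows "expectation (incr n j) = expectation (X 0 1) / 2 ^ n"
proof -
  have eq: "expectation (incr n i) = expectation (incr n j)" if "i < 2 ^ n" for i
  proof -
    have "expectation (incr n i) = (\<integral>x. x \<partial>distr M borel (incr n i))" using that by (subst integral_distr) auto
    also have "\<dots> = (\<integral>x. x \<partial>distr M borel (incr n j))" using that assms by (simp add: distr_incr_single)
    also have "\<dots> = expectation (incr n j)" using assms by (subst integral_distr) auto
    finally show ?thesis .
  qed
  have "expectation (X 0 1) = expectation (\<lambda>\<omega>. \<Sum>i\<in>{0..<2 ^ n}. incr n i \<omega>)"
    by (intro Bochner_Integration.integral_cong refl) (simp add: X_last X_0 flip: X_diff)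
  also have "\<dots> = (\<Sum>i\<in>{0..<2 ^ n}. expectation (incr n i))"
    by (intro Bochner_Integration.integral_sum incr_integrable) auto
  also have "\<dots> = 2 ^ n * expectation (incr n j)" using eq by simp
  finally show ?thesis by simp
qed

text \<open>Splitting the terminal value into an increment \<open>A\<close> and the independent rest \<open>B\<close>, Jensen's inequality
  bounds the \<open>p\<close>-th moment of \<open>A\<close> on the event that \<open>A\<close> is large by that of the terminal value, up to a
  constant. That event has small probability when the increment is over a short time.\<close>

lemma small_increment_moment:
  assumes \<delta>: "0 < \<delta>"
  obtains \<eta> where "0 < \<eta>"
    and "\<And>n a b. a \<le> b \<Longrightarrow> b \<le> 2 ^ n \<Longrightarrow> real (b - a) * T / 2 ^ n < \<eta> \<Longrightarrow>
      (\<integral>\<^sup>+\<omega>. ennreal (\<bar>X n b \<omega> - X n a \<omega>\<bar> powr p) \<partial>M) \<le> ennreal \<delta>"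
proof -
  define m where "m = expectation (X 0 1)"
  \<comment> \<open>\<open>G\<close> bounds the p-th power of the terminal value after any centring
    by a number of absolute value at most |m|, so it is the same for all n, a and b.\<close>
  define G where "G \<omega> = 2 powr p * (\<bar>X 0 1 \<omega>\<bar> powr p + \<bar>m\<bar> powr p)" for \<omega>
  have "integrable M (\<lambda>\<omega>. \<bar>X 0 1 \<omega>\<bar> powr p)"
    using X_last_moment by (intro integrableI_nonneg) auto
  then have G: "integrable M G" "\<And>\<omega>. 0 \<le> G \<omega>" unfolding G_def[abs_def] by auto
  \<comment> \<open>The event |A| \<le> \<epsilon> contributes at most
    \<open>\<epsilon> powr p = \<delta> / 2\<close>; the other half of \<delta> is left for the
    tail.\<close>
  define \<epsilon> where "\<epsilon> = (\<delta> / 2) powr (1 / p)"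
  have \<epsilon>: "0 < \<epsilon>" "\<epsilon> powr p = \<delta> / 2" using \<delta> p by (auto simp: \<epsilon>_def powr_powr)
  obtain \<theta> where \<theta>: "0 < \<theta>"
    "\<And>A. A \<in> events \<Longrightarrow> prob A < \<theta> \<Longrightarrow> (\<integral>\<^sup>+\<omega>. ennreal (G \<omega>) * indicator A \<omega> \<partial>M) \<le> ennreal (\<delta> / 2)"
    using nn_integral_absolutely_continuous[OF G, of "\<delta> / 2"] \<delta> by auto
  obtain \<eta> where \<eta>: "0 < \<eta>"
    "\<And>s \<mu>. 0 \<le> s \<Longrightarrow> s < \<eta> \<Longrightarrow> real_distribution \<mu> \<Longrightarrow> (\<And>u. char \<mu> u = exp (of_real s * \<psi> u)) \<Longrightarrow>
      measure \<mu> {x. \<bar>x\<bar> > \<epsilon>} < \<theta>"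
    using small_time_tail[OF \<epsilon>(1) \<theta>(1), of \<psi>] by metis
  show thesis
  proof (rule that[OF \<eta>(1)])
    fix n a b :: nat assume ab: "a \<le> b" "b \<le> 2 ^ n" and small: "real (b - a) * T / 2 ^ n < \<eta>"
    define A where "A \<omega> = X n b \<omega> - X n a \<omega>" for \<omega>
    define K where "K = {..<a} \<union> {b..<2 ^ n}"
    define B where "B \<omega> = (\<Sum>j\<in>K. incr n j \<omega>)" for \<omega>
    let ?S = "{x::real. \<bar>x\<bar> > \<epsilon>}"
    have [measurable]: "A \<in> borel_measurable M" unfolding A_def[abs_def] using ab by (intro borel_measurable_diff X_measurable) auto
    have K: "K \<subseteq> {..<2 ^ n}" "K \<inter> {a..<b} = {}" "K \<union> {a..<b} = {..<2 ^ n}" "finite K"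
      using ab by (auto simp: K_def)
    have A_sum: "A = (\<lambda>\<omega>. \<Sum>j\<in>{a..<b}. incr n j \<omega>)" using X_diff[OF ab] by (simp add: A_def fun_eq_iff)
    have "indep_vars (\<lambda>_. borel) (\<lambda>c \<omega>. \<Sum>j\<in>(case_bool {a..<b} K c). incr n j \<omega>) UNIV"
      using K ab by (intro indep_vars_block_sum[OF indep_incr])
        (auto simp: disjoint_family_on_def split: bool.splits)
    moreover have "(\<lambda>c \<omega>. \<Sum>j\<in>(case_bool {a..<b} K c). incr n j \<omega>) = case_bool A B"
      unfolding A_sum B_def[abs_def] by (auto simp: fun_eq_iff split: bool.split)
    moreover have "case_bool borel borel = (\<lambda>_. borel :: real measure)" by (auto simp: fun_eq_iff split: bool.split)
    ultimately have ind: "indep_var borel A borel B" by (simp add: indep_var_def)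
    have B_int: "integrable M B"
      unfolding B_def[abs_def] using K by (intro Bochner_Integration.integrable_sum incr_integrable) auto
    have AB: "A \<omega> + B \<omega> = X 0 1 \<omega>" if "\<omega> \<in> space M" for \<omega>
    proof -
      have "A \<omega> + B \<omega> = (\<Sum>j\<in>K \<union> {a..<b}. incr n j \<omega>)"
        unfolding A_sum B_def using K by (subst sum.union_disjoint) auto
      also have "K \<union> {a..<b} = {0..<2 ^ n}" using K by auto
      finally show ?thesis using that by (simp add: X_last X_0 flip: X_diff)
    qed
    have EB: "\<bar>expectation B\<bar> \<le> \<bar>m\<bar>"
    proof -
      have "expectation B = (\<Sum>j\<in>K. expectation (incr n j))"
        unfolding B_def[abs_def] using K by (intro Bochner_Integration.integral_sum incr_integrable) auto
      also have "\<dots> = (\<Sum>j\<in>K. m / 2 ^ n)"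
        using K(1) by (intro sum.cong refl) (auto simp: expectation_incr m_def)
      finally have "expectation B = (\<Sum>j\<in>K. m / 2 ^ n)" .
      then have "\<bar>expectation B\<bar> = (real (card K) / 2 ^ n) * \<bar>m\<bar>" by (simp add: abs_mult)
      moreover have "real (card K) * \<bar>m\<bar> \<le> 2 ^ n * \<bar>m\<bar>"
        using card_mono[OF _ K(1)] by (intro mult_right_mono) (simp_all add: of_nat_le_iff[symmetric] del: of_nat_le_iff)
      ultimately have "\<bar>expectation B\<bar> * 2 ^ n \<le> \<bar>m\<bar> * 2 ^ n" by (simp add: field_simps)
      then show ?thesis by (rule mult_right_le_imp_le) simp
    qed
    have S: "prob {\<omega> \<in> space M. A \<omega> \<in> ?S} < \<theta>"
    proof -
      have "measure (distr M borel A) ?S < \<theta>"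
      proof (rule \<eta>(2)[OF _ small])
        show "char (distr M borel A) u = exp (of_real (real (b - a) * T / 2 ^ n) * \<psi> u)" for u
          unfolding A_def[abs_def] by (rule char_X_diff[OF ab])
      qed (use T in \<open>auto intro!: real_distribution_distr\<close>)
      then show ?thesis by (subst (asm) measure_distr) (auto simp: vimage_def Int_def conj_commute)
    qed
    have "(\<integral>\<^sup>+\<omega>. ennreal (\<bar>A \<omega>\<bar> powr p) \<partial>M) \<le>
        (\<integral>\<^sup>+\<omega>. ennreal (\<epsilon> powr p) + ennreal (\<bar>A \<omega>\<bar> powr p) * indicator ?S (A \<omega>) \<partial>M)"
      using p by (intro nn_integral_mono) (auto split: split_indicator intro!: ennreal_leI powr_mono2)
    also have "\<dots> = ennreal (\<delta> / 2) + (\<integral>\<^sup>+\<omega>. ennreal (\<bar>A \<omega>\<bar> powr p) * indicator ?S (A \<omega>) \<partial>M)"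
      unfolding \<epsilon>(2) by (simp add: nn_integral_add emeasure_space_1)
    also have "(\<integral>\<^sup>+\<omega>. ennreal (\<bar>A \<omega>\<bar> powr p) * indicator ?S (A \<omega>) \<partial>M) \<le>
        (\<integral>\<^sup>+\<omega>. ennreal (\<bar>A \<omega> + B \<omega> - expectation B\<bar> powr p) * indicator ?S (A \<omega>) \<partial>M)"
      by (rule indep_centered_powr_le[OF p ind B_int]) simp
    also have "\<dots> \<le> (\<integral>\<^sup>+\<omega>. ennreal (G \<omega>) * indicator {\<omega> \<in> space M. A \<omega> \<in> ?S} \<omega> \<partial>M)"
    proof (rule nn_integral_mono)
      fix \<omega> assume \<omega>: "\<omega> \<in> space M"
      have "\<bar>A \<omega> + B \<omega> - expectation B\<bar> powr p \<le> 2 powr p * (\<bar>X 0 1 \<omega>\<bar> powr p + \<bar>expectation B\<bar> powr p)"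
        using abs_add_powr_le[of p "X 0 1 \<omega>" "- expectation B"] p AB[OF \<omega>] by simp
      also have "\<dots> \<le> G \<omega>"
        unfolding G_def using EB p by (intro mult_left_mono add_left_mono powr_mono2) auto
      finally show "ennreal (\<bar>A \<omega> + B \<omega> - expectation B\<bar> powr p) * indicator ?S (A \<omega>) \<le>
          ennreal (G \<omega>) * indicator {\<omega> \<in> space M. A \<omega> \<in> ?S} \<omega>"
        using \<omega> by (auto split: split_indicator intro: ennreal_leI)
    qed
    also have "\<dots> \<le> ennreal (\<delta> / 2)" by (rule \<theta>(2)[OF _ S]) measurable
    finally show "(\<integral>\<^sup>+\<omega>. ennreal (\<bar>X n b \<omega> - X n a \<omega>\<bar> powr p) \<partial>M) \<le> ennreal \<delta>"
      using \<delta> by (simp add: A_def flip: ennreal_plus)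
  qed
qed

subsection \<open>The limit process\<close>

definition grid_index :: "nat \<Rightarrow> real \<Rightarrow> nat" where
  "grid_index n t = nat \<lfloor>t * 2 ^ n / T\<rfloor>"

lemma grid_index_le: "0 \<le> t \<Longrightarrow> real (grid_index n t) * T / 2 ^ n \<le> t"
  and grid_index_gt: "0 \<le> t \<Longrightarrow> t < (real (grid_index n t) + 1) * T / 2 ^ n"
proof -
  assume t: "0 \<le> t"
  then have k: "real (grid_index n t) = of_int \<lfloor>t * 2 ^ n / T\<rfloor>"
    using T by (simp add: grid_index_def)
  then have "real (grid_index n t) \<le> t * 2 ^ n / T" "t * 2 ^ n / T < real (grid_index n t) + 1"
    by linarith+
  then show "real (grid_index n t) * T / 2 ^ n \<le> t" "t < (real (grid_index n t) + 1) * T / 2 ^ n"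
    using T by (simp_all add: field_simps)
qed

lemma grid_index_grid: "grid_index n (real j * T / 2 ^ n) = j"
  using T by (simp add: grid_index_def)

lemma grid_index_mono: "s \<le> t \<Longrightarrow> grid_index n s \<le> grid_index n t"
  using T unfolding grid_index_def by (intro nat_mono floor_mono divide_right_mono mult_right_mono) auto

lemma grid_index_T: "grid_index n T = 2 ^ n"
  using grid_index_grid[of n "2 ^ n"] by simp

lemma grid_index_bound: "t \<le> T \<Longrightarrow> grid_index n t \<le> 2 ^ n"
  using grid_index_mono[of t T n] by (simp add: grid_index_T)

lemma grid_index_bound_less: "0 \<le> t \<Longrightarrow> t < T \<Longrightarrow> grid_index n t < 2 ^ n"
proof -
  assume t: "0 \<le> t" "t < T"
  then have "real (grid_index n t) * T / 2 ^ n < real (2 ^ n) * T / 2 ^ n"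
    using grid_index_le[of t n] by simp
  then have "real (grid_index n t) < real (2 ^ n)" using T by (simp only: divide_less_cancel mult_less_cancel_right) auto
  then show ?thesis by (simp only: of_nat_less_iff)
qed

text \<open>The half-open cells never contain T, so there only the separate term counts. At an
  earlier t the one active cell has the right endpoint index \<open>Suc (grid_index n t)\<close>,
  and the process takes the value at its left endpoint.\<close>

lemma bridge_process_eq:
  assumes t: "t \<in> {0..T}"
  shows "bridge_process T X n t = X n (grid_index n t)"
proof
  fix \<omega>
  show "bridge_process T X n t \<omega> = X n (grid_index n t) \<omega>"
  proof (cases "t = T")
    case True
    have "(\<Sum>j = 1..2 ^ n. X n (j - 1) \<omega> * indicator {real (j - 1) * T / 2 ^ n ..< real j * T / 2 ^ n} t) = 0"
    proof (rule sum.neutral, rule ballI)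
      fix j :: nat assume "j \<in> {1..2 ^ n}"
      then have "real j \<le> real (2 ^ n)" by (intro of_nat_mono) auto
      then have "real j * T / 2 ^ n \<le> T" using T by (simp add: field_simps)
      then show "X n (j - 1) \<omega> * indicator {real (j - 1) * T / 2 ^ n ..< real j * T / 2 ^ n} t = 0"
        using True by simp
    qed
    then show ?thesis using True by (simp add: bridge_process_def grid_index_T)
  next
    case False
    let ?k = "grid_index n t"
    have k: "?k < 2 ^ n" using False t by (intro grid_index_bound_less) auto
    have ind: "indicator {real (j - 1) * T / 2 ^ n ..< real j * T / 2 ^ n} t = (if j = Suc ?k then 1 else 0 :: real)"
      if "j \<in> {1..2 ^ n}" for j
    proof (cases "j = Suc ?k")
      case True
      then show ?thesis using grid_index_le[of t n] grid_index_gt[of t n] t by (simp add: add.commute)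
    next
      case ne: False
      have "\<not> (real (j - 1) * T / 2 ^ n \<le> t \<and> t < real j * T / 2 ^ n)"
      proof
        assume a: "real (j - 1) * T / 2 ^ n \<le> t \<and> t < real j * T / 2 ^ n"
        then have "grid_index n (real (j - 1) * T / 2 ^ n) \<le> ?k" by (intro grid_index_mono) auto
        then have "j - 1 \<le> ?k" by (simp only: grid_index_grid)
        moreover have "real ?k * T / 2 ^ n < real j * T / 2 ^ n"
          using a grid_index_le[of t n] t by auto
        then have "?k < j" using T by (simp add: divide_less_cancel)
        ultimately show False using ne by auto
      qed
      then show ?thesis using ne by auto
    qed
    have "(\<Sum>j = 1..2 ^ n. X n (j - 1) \<omega> * indicator {real (j - 1) * T / 2 ^ n ..< real j * T / 2 ^ n} t) =
        (\<Sum>j = 1..2 ^ n. if j = Suc ?k then X n ?k \<omega> else 0)"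
      using ind by (intro sum.cong refl) auto
    also have "\<dots> = X n ?k \<omega>" using k by simp
    finally show ?thesis using False by (simp add: bridge_process_def)
  qed
qed

lemma bridge_process_measurable [measurable (raw)]:
  "t \<in> {0..T} \<Longrightarrow> bridge_process T X n t \<in> borel_measurable M"
  by (subst bridge_process_eq) (auto intro!: X_measurable grid_index_bound)

lemma step_tendsto_0: "(\<lambda>n. T / 2 ^ n) \<longlonglongrightarrow> 0"
  by (intro LIMSEQ_divide_realpow_zero) simp

lemma grid_index_tendsto: "0 \<le> t \<Longrightarrow> (\<lambda>n. real (grid_index n t) * T / 2 ^ n) \<longlonglongrightarrow> t"
proof -
  assume t: "0 \<le> t"
  have "(\<lambda>n. t - T / 2 ^ n) \<longlonglongrightarrow> t - 0" by (intro tendsto_intros step_tendsto_0)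
  then have l: "(\<lambda>n. t - T / 2 ^ n) \<longlonglongrightarrow> t" by simp
  show ?thesis
  proof (rule tendsto_sandwich[OF _ _ l tendsto_const])
    show "\<forall>\<^sub>F n in sequentially. t - T / 2 ^ n \<le> real (grid_index n t) * T / 2 ^ n"
      using grid_index_gt[OF t] by (intro always_eventually allI) (simp add: distrib_right add_divide_distrib less_imp_le diff_le_eq)
  qed (use grid_index_le[OF t] in auto)
qed

text \<open>Refinement keeps old values, so the level n value at t is also a level m value, at index
  \<open>2 ^ (m - n) * grid_index n t\<close>. The difference is then an increment of a single level
  over a time less than \<open>T / 2 ^ n\<close>, to which \<open>small_increment_moment\<close>
  applies.\<close>

lemma bridge_process_Cauchy:
  assumes t: "t \<in> {0..T}" and \<delta>: "0 < \<delta>"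
  shows "\<exists>N. \<forall>n\<ge>N. \<forall>m\<ge>n. (\<integral>\<^sup>+\<omega>. ennreal (\<bar>bridge_process T X m t \<omega> - bridge_process T X n t \<omega>\<bar> powr p) \<partial>M) \<le> ennreal \<delta>"
proof -
  obtain \<eta> where \<eta>: "0 < \<eta>" "\<And>n a b. a \<le> b \<Longrightarrow> b \<le> 2 ^ n \<Longrightarrow> real (b - a) * T / 2 ^ n < \<eta> \<Longrightarrow>
      (\<integral>\<^sup>+\<omega>. ennreal (\<bar>X n b \<omega> - X n a \<omega>\<bar> powr p) \<partial>M) \<le> ennreal \<delta>"
    using small_increment_moment[OF \<delta>] by blast
  obtain N where N: "\<And>n. N \<le> n \<Longrightarrow> T / 2 ^ n < \<eta>"
    using order_tendstoD(2)[OF step_tendsto_0 \<eta>(1)] by (auto simp: eventually_sequentially)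
  show ?thesis
  proof (intro exI allI impI)
    fix n m assume n: "N \<le> n" and m: "n \<le> m"
    define d where "d = m - n"
    have md: "m = d + n" using m by (simp add: d_def)
    let ?a = "2 ^ d * grid_index n t" and ?b = "grid_index m t"
    have at: "real ?a * T / 2 ^ m = real (grid_index n t) * T / 2 ^ n"
      by (simp add: md power_add)
    have "grid_index m (real ?a * T / 2 ^ m) \<le> ?b"
      unfolding at using grid_index_le[of t n] t by (intro grid_index_mono) auto
    then have ab: "?a \<le> ?b" by (simp only: grid_index_grid)
    have b: "?b \<le> 2 ^ m" using t by (intro grid_index_bound) auto
    have "real (?b - ?a) * T / 2 ^ m = real ?b * T / 2 ^ m - real ?a * T / 2 ^ m"
      using ab by (simp add: of_nat_diff left_diff_distrib diff_divide_distrib)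
    also have "\<dots> < T / 2 ^ n"
      using grid_index_le[of t m] grid_index_gt[of t n] t unfolding at by (simp add: distrib_right add_divide_distrib)
    finally have "real (?b - ?a) * T / 2 ^ m < \<eta>" using N[OF n] by simp
    from \<eta>(2)[OF ab b this]
    have "(\<integral>\<^sup>+\<omega>. ennreal (\<bar>X m ?b \<omega> - X m ?a \<omega>\<bar> powr p) \<partial>M) \<le> ennreal \<delta>" .
    also have "(\<integral>\<^sup>+\<omega>. ennreal (\<bar>X m ?b \<omega> - X m ?a \<omega>\<bar> powr p) \<partial>M) =
        (\<integral>\<^sup>+\<omega>. ennreal (\<bar>bridge_process T X m t \<omega> - bridge_process T X n t \<omega>\<bar> powr p) \<partial>M)"
      using X_refine_iter[of "grid_index n t" n _ d] grid_index_bound[of t n] t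
      by (intro nn_integral_cong) (simp add: bridge_process_eq md)
    finally show "(\<integral>\<^sup>+\<omega>. ennreal (\<bar>bridge_process T X m t \<omega> - bridge_process T X n t \<omega>\<bar> powr p) \<partial>M) \<le> ennreal \<delta>" .
  qed
qed

text \<open>The subsequence may differ from time to time: each property of the limit below concerns
  finitely many times and rests on L^p convergence of the full sequence, on the value at 0, or on
  measurability at a single time.\<close>

definition limit_subseq :: "real \<Rightarrow> nat \<Rightarrow> nat" where
  "limit_subseq t = (SOME r. (\<lambda>n. \<integral>\<^sup>+\<omega>. ennreal (\<bar>bridge_process T X n t \<omega> -
     lim (\<lambda>k. bridge_process T X (r k) t \<omega>)\<bar> powr p) \<partial>M) \<longlonglongrightarrow> 0)"

definition limit_process :: "real \<Rightarrow> 'a \<Rightarrow> real" where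
  "limit_process t \<omega> = lim (\<lambda>k. bridge_process T X (limit_subseq t k) t \<omega>)"

lemma limit_process_Lp:
  assumes t: "t \<in> {0..T}"
  shows "(\<lambda>n. \<integral>\<^sup>+\<omega>. ennreal (\<bar>bridge_process T X n t \<omega> - limit_process t \<omega>\<bar> powr p) \<partial>M) \<longlonglongrightarrow> 0"
proof -
  have "\<exists>r. (\<lambda>n. \<integral>\<^sup>+\<omega>. ennreal (\<bar>bridge_process T X n t \<omega> -
      lim (\<lambda>k. bridge_process T X (r k) t \<omega>)\<bar> powr p) \<partial>M) \<longlonglongrightarrow> 0"
    by (rule Lp_Cauchy_limit[OF p bridge_process_measurable[OF t] bridge_process_Cauchy[OF t]], assumption, rule exI)
  then show ?thesis
    unfolding limit_process_def limit_subseq_def by (rule someI_ex)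
qed

lemma limit_process_measurable [measurable (raw)]:
  "t \<in> {0..T} \<Longrightarrow> limit_process t \<in> borel_measurable M"
  unfolding limit_process_def[abs_def] by (intro borel_measurable_lim_metric bridge_process_measurable)

lemma limit_process_L1:
  assumes t: "t \<in> {0..T}"
  shows "(\<lambda>n. \<integral>\<^sup>+\<omega>. ennreal \<bar>bridge_process T X n t \<omega> - limit_process t \<omega>\<bar> \<partial>M) \<longlonglongrightarrow> 0"
  using t by (intro Lp_tendsto_imp_L1_tendsto[OF p _ limit_process_Lp]) auto

lemma limit_process_0: "\<omega> \<in> space M \<Longrightarrow> limit_process 0 \<omega> = 0"
  using T by (simp add: limit_process_def bridge_process_eq grid_index_def X_0 limI)

lemma limit_process_diff_L1:
  assumes "s \<in> {0..T}" "t \<in> {0..T}"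
  shows "(\<lambda>n. \<integral>\<^sup>+\<omega>. ennreal \<bar>(bridge_process T X n t \<omega> - bridge_process T X n s \<omega>) - (limit_process t \<omega> - limit_process s \<omega>)\<bar> \<partial>M) \<longlonglongrightarrow> 0"
  using assms by (intro L1_tendsto_diff limit_process_L1) auto

text \<open>At level n the exponent is the distance of the two times rounded down to the grid, which
  tends to t - s; the characteristic functions themselves converge because the increments do so in
  L^1.\<close>

lemma char_limit_process_diff:
  assumes "0 \<le> s" "s \<le> t" "t \<le> T"
  shows "char (distr M borel (\<lambda>\<omega>. limit_process t \<omega> - limit_process s \<omega>)) u = exp (of_real (t - s) * \<psi> u)"
proof (rule LIMSEQ_unique)
  have st: "s \<in> {0..T}" "t \<in> {0..T}" using assms by auto
  show "(\<lambda>n. char (distr M borel (\<lambda>\<omega>. bridge_process T X n t \<omega> - bridge_process T X n s \<omega>)) u) \<longlonglongrightarrow>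
      char (distr M borel (\<lambda>\<omega>. limit_process t \<omega> - limit_process s \<omega>)) u"
    using st by (intro char_tendsto_L1 limit_process_diff_L1) auto
  have "char (distr M borel (\<lambda>\<omega>. bridge_process T X n t \<omega> - bridge_process T X n s \<omega>)) u =
      exp (of_real (real (grid_index n t) * T / 2 ^ n - real (grid_index n s) * T / 2 ^ n) * \<psi> u)" for n
  proof -
    have k: "grid_index n s \<le> grid_index n t" "grid_index n t \<le> 2 ^ n"
      using assms by (auto intro: grid_index_mono grid_index_bound)
    show ?thesis
      unfolding bridge_process_eq[OF st(1)] bridge_process_eq[OF st(2)] char_X_diff[OF k]
      using k by (simp add: of_nat_diff left_diff_distrib diff_divide_distrib)
  qed
  moreover have "(\<lambda>n. exp (of_real (real (grid_index n t) * T / 2 ^ n - real (grid_index n s) * T / 2 ^ n) * \<psi> u)) \<longlonglongrightarrow>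
      exp (of_real (t - s) * \<psi> u)"
    using assms by (intro tendsto_intros grid_index_tendsto) auto
  ultimately show "(\<lambda>n. char (distr M borel (\<lambda>\<omega>. bridge_process T X n t \<omega> - bridge_process T X n s \<omega>)) u) \<longlonglongrightarrow>
      exp (of_real (t - s) * \<psi> u)" by simp
qed

text \<open>At each level these increments are sums over blocks of grid increments. Rounding is
  monotone, so the blocks are disjoint, though possibly empty, and independence survives the L^1
  limit.\<close>

lemma indep_limit_process_increments:
  fixes s :: "nat \<Rightarrow> real"
  assumes s: "0 \<le> s 0" "\<And>i. i < n \<Longrightarrow> s i \<le> s (Suc i)" "s n \<le> T"
  shows "indep_vars (\<lambda>_. borel) (\<lambda>i \<omega>. limit_process (s (Suc i)) \<omega> - limit_process (s i) \<omega>) {..<n}"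
proof -
  have mono: "s i \<le> s j" if "i \<le> j" "j \<le> n" for i j
    using that by (induction j rule: dec_induct) (auto intro: order_trans[OF _ s(2)])
  have sT: "s i \<in> {0..T}" if "i \<le> n" for i
    using mono[of 0 i] mono[of i n] that s by auto
  show ?thesis
  proof (rule indep_vars_L1_limit)
    fix m
    have "indep_vars (\<lambda>_. borel) (\<lambda>i \<omega>. \<Sum>j\<in>{grid_index m (s i)..<grid_index m (s (Suc i))}. incr m j \<omega>) {..<n}"
    proof (rule indep_vars_block_sum[OF indep_incr])
      show "{grid_index m (s i)..<grid_index m (s (Suc i))} \<subseteq> {..<2 ^ m}" if "i \<in> {..<n}" for i
        using grid_index_bound[of "s (Suc i)" m] sT[of "Suc i"] that by auto
      show "disjoint_family_on (\<lambda>i. {grid_index m (s i)..<grid_index m (s (Suc i))}) {..<n}"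
      proof -
        have "{grid_index m (s i)..<grid_index m (s (Suc i))} \<inter> {grid_index m (s j)..<grid_index m (s (Suc j))} = {}"
          if "i < j" "j < n" for i j
          using grid_index_mono[OF mono[of "Suc i" j], of m] that by auto
        then show ?thesis
          unfolding disjoint_family_on_def by (metis Int_commute lessThan_iff linorder_neqE_nat)
      qed
    qed
    also have "?this \<longleftrightarrow> indep_vars (\<lambda>_. borel) (\<lambda>i \<omega>. bridge_process T X m (s (Suc i)) \<omega> - bridge_process T X m (s i) \<omega>) {..<n}"
    proof (rule indep_vars_cong)
      fix i assume i: "i \<in> {..<n}"
      then have i': "s i \<in> {0..T}" "s (Suc i) \<in> {0..T}" using sT[of i] sT[of "Suc i"] by auto
      show "(\<lambda>\<omega>. \<Sum>j\<in>{grid_index m (s i)..<grid_index m (s (Suc i))}. incr m j \<omega>) =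
          (\<lambda>\<omega>. bridge_process T X m (s (Suc i)) \<omega> - bridge_process T X m (s i) \<omega>)"
        unfolding bridge_process_eq[OF i'(1)] bridge_process_eq[OF i'(2)]
        using i i' s by (intro ext X_diff[symmetric] grid_index_mono grid_index_bound) auto
    qed auto
    finally show "indep_vars (\<lambda>_. borel) (\<lambda>i \<omega>. bridge_process T X m (s (Suc i)) \<omega> - bridge_process T X m (s i) \<omega>) {..<n}" .
  next
    fix i assume "i \<in> {..<n}"
    then have i': "s i \<in> {0..T}" "s (Suc i) \<in> {0..T}" using sT[of i] sT[of "Suc i"] by auto
    then show "(\<lambda>\<omega>. limit_process (s (Suc i)) \<omega> - limit_process (s i) \<omega>) \<in> borel_measurable M"
      by measurable
    show "(\<lambda>m. \<integral>\<^sup>+\<omega>. ennreal \<bar>(bridge_process T X m (s (Suc i)) \<omega> - bridge_process T X m (s i) \<omega>) -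
        (limit_process (s (Suc i)) \<omega> - limit_process (s i) \<omega>)\<bar> \<partial>M) \<longlonglongrightarrow> 0"
      by (rule limit_process_diff_L1[OF i'])
  qed simp
qed

text \<open>The characteristic function of an increment depends only on the length of the time
  interval, so one \<eta> from \<open>small_time_tail\<close> serves s on either side of t.\<close>

lemma limit_process_stochastic_continuity:
  assumes t: "t \<in> {0..T}" and \<epsilon>: "0 < \<epsilon>"
  shows "((\<lambda>s. prob {\<omega> \<in> space M. \<bar>limit_process s \<omega> - limit_process t \<omega>\<bar> > \<epsilon>}) \<longlongrightarrow> 0) (at t within {0..T})"
proof (rule order_tendstoI)
  fix \<theta> :: real assume \<theta>: "0 < \<theta>"
  obtain \<eta> where \<eta>: "0 < \<eta>"
    "\<And>s \<mu>. 0 \<le> s \<Longrightarrow> s < \<eta> \<Longrightarrow> real_distribution \<mu> \<Longrightarrow> (\<And>u. char \<mu> u = exp (of_real s * \<psi> u)) \<Longrightarrow>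
      measure \<mu> {x. \<bar>x\<bar> > \<epsilon>} < \<theta>"
    using small_time_tail[OF \<epsilon> \<theta>, of \<psi>] by metis
  have *: "prob {\<omega> \<in> space M. \<bar>limit_process b \<omega> - limit_process a \<omega>\<bar> > \<epsilon>} < \<theta>"
    if ab: "0 \<le> a" "a \<le> b" "b \<le> T" "b - a < \<eta>" for a b
  proof -
    have [measurable]: "limit_process a \<in> borel_measurable M" "limit_process b \<in> borel_measurable M"
      using ab by (auto intro!: limit_process_measurable)
    let ?D = "\<lambda>\<omega>. limit_process b \<omega> - limit_process a \<omega>"
    have "measure (distr M borel ?D) {x. \<bar>x\<bar> > \<epsilon>} < \<theta>"
      using ab by (intro \<eta>(2)[of "b - a"] char_limit_process_diff real_distribution_distr) auto
    then show ?thesis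
      by (subst (asm) measure_distr) (auto simp: vimage_def Int_def conj_commute)
  qed
  have "prob {\<omega> \<in> space M. \<bar>limit_process s \<omega> - limit_process t \<omega>\<bar> > \<epsilon>} < \<theta>"
    if "s \<in> {0..T}" "dist s t < \<eta>" for s
    using *[of s t] *[of t s] that t by (cases "s \<le> t") (auto simp: dist_real_def abs_minus_commute)
  then show "\<forall>\<^sub>F s in at t within {0..T}. prob {\<omega> \<in> space M. \<bar>limit_process s \<omega> - limit_process t \<omega>\<bar> > \<epsilon>} < \<theta>"
    using \<eta>(1) by (auto simp: eventually_at)
qed (auto intro!: always_eventually less_le_trans[OF _ measure_nonneg])

lemma levy_process_limit_process: "levy_process M T limit_process"
  unfolding levy_process_def
proof (intro conjI allI impI ballI)
  show "AE \<omega> in M. limit_process 0 \<omega> = 0" using limit_process_0 by auto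
next
  fix n :: nat and s :: "nat \<Rightarrow> real"
  assume "0 \<le> s 0 \<and> (\<forall>i<n. s i \<le> s (Suc i)) \<and> s n \<le> T"
  then show "indep_vars (\<lambda>_. borel) (\<lambda>i \<omega>. limit_process (s (Suc i)) \<omega> - limit_process (s i) \<omega>) {..<n}"
    by (intro indep_limit_process_increments) auto
next
  fix s h assume a: "0 \<le> s \<and> 0 \<le> h \<and> s + h \<le> T"
  then have [measurable]: "limit_process s \<in> borel_measurable M" "limit_process (s + h) \<in> borel_measurable M"
      "limit_process h \<in> borel_measurable M" "limit_process 0 \<in> borel_measurable M"
    by (auto intro!: limit_process_measurable)
  show "distr M borel (\<lambda>\<omega>. limit_process (s + h) \<omega> - limit_process s \<omega>) =
      distr M borel (\<lambda>\<omega>. limit_process h \<omega> - limit_process 0 \<omega>)"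
    using a by (intro Levy_uniqueness real_distribution_distr) (auto simp: char_limit_process_diff fun_eq_iff)
qed (auto intro: limit_process_measurable limit_process_stochastic_continuity)

lemma char_limit_process:
  assumes t: "t \<in> {0..T}"
  shows "char (distr M borel (limit_process t)) = (\<lambda>u. exp (of_real t * \<psi> u))"
proof
  fix u
  have "distr M borel (limit_process t) = distr M borel (\<lambda>\<omega>. limit_process t \<omega> - limit_process 0 \<omega>)"
    by (intro distr_cong) (auto simp: limit_process_0)
  then show "char (distr M borel (limit_process t)) u = exp (of_real t * \<psi> u)"
    using char_limit_process_diff[of 0 t u] t by simp
qed

section \<open>Adaptedness of the limit and independence of the past\<close>

text \<open>For independence of the past at time \<open>s\<close> one has to approximate \<open>s\<close> by grid points from above,
  since only increments after \<open>s\<close> are independent of the past.\<close>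

definition upper_index :: "nat \<Rightarrow> real \<Rightarrow> nat" where
  "upper_index n t = min (Suc (grid_index n t)) (2 ^ n)"

lemma upper_index_bound: "upper_index n t \<le> 2 ^ n"
  by (simp add: upper_index_def)

lemma upper_index_mono: "s \<le> t \<Longrightarrow> upper_index n s \<le> upper_index n t"
  using grid_index_mono[of s t n] by (auto simp: upper_index_def)

lemma upper_index_ge:
  assumes t: "t \<in> {0..T}"
  shows "t \<le> real (upper_index n t) * T / 2 ^ n"
proof (cases "Suc (grid_index n t) \<le> 2 ^ n")
  case True
  then show ?thesis using grid_index_gt[of t n] t by (simp add: upper_index_def add.commute)
next
  case False
  then show ?thesis using t by (simp add: upper_index_def)
qed

text \<open>The upper and lower grid indices differ by at most one step, and the p-th moment of an
  increment over one step tends to 0; both roundings therefore have the same limit.\<close>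

lemma upper_index_L1:
  assumes t: "t \<in> {0..T}"
  shows "(\<lambda>n. \<integral>\<^sup>+\<omega>. ennreal \<bar>X n (upper_index n t) \<omega> - limit_process t \<omega>\<bar> \<partial>M) \<longlonglongrightarrow> 0"
proof -
  let ?d = "\<lambda>n \<omega>. X n (upper_index n t) \<omega> - X n (grid_index n t) \<omega>"
  have b: "grid_index n t \<le> 2 ^ n" "grid_index n t \<le> upper_index n t" for n
    using t grid_index_bound[of t n] by (auto simp: upper_index_def)
  note [measurable] = X_measurable[OF b(1)] X_measurable[OF upper_index_bound]
    limit_process_measurable[OF t]
  have "(\<lambda>n. \<integral>\<^sup>+\<omega>. ennreal (\<bar>?d n \<omega>\<bar> powr p) \<partial>M) \<longlonglongrightarrow> 0"
  proof (rule order_tendstoI)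
    fix a :: ennreal assume "0 < a"
    then obtain \<delta> where \<delta>: "0 < \<delta>" "ennreal \<delta> < a" by (rule ennreal_pos_real_less)
    obtain \<eta> where \<eta>: "0 < \<eta>" "\<And>n a b. a \<le> b \<Longrightarrow> b \<le> 2 ^ n \<Longrightarrow> real (b - a) * T / 2 ^ n < \<eta> \<Longrightarrow>
        (\<integral>\<^sup>+\<omega>. ennreal (\<bar>X n b \<omega> - X n a \<omega>\<bar> powr p) \<partial>M) \<le> ennreal \<delta>"
      using small_increment_moment[OF \<delta>(1)] by blast
    have "\<forall>\<^sub>F n in sequentially. T / 2 ^ n < \<eta>"
      by (rule order_tendstoD(2)[OF step_tendsto_0 \<eta>(1)])
    then show "\<forall>\<^sub>F n in sequentially. (\<integral>\<^sup>+\<omega>. ennreal (\<bar>?d n \<omega>\<bar> powr p) \<partial>M) < a"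
    proof eventually_elim
      case (elim n)
      have "real (upper_index n t - grid_index n t) \<le> 1" by (simp add: upper_index_def)
      then have "real (upper_index n t - grid_index n t) * T / 2 ^ n \<le> 1 * T / 2 ^ n"
        using T by (intro divide_right_mono mult_right_mono) auto
      then have "(\<integral>\<^sup>+\<omega>. ennreal (\<bar>?d n \<omega>\<bar> powr p) \<partial>M) \<le> ennreal \<delta>"
        using elim by (intro \<eta>(2) b upper_index_bound) auto
      then show ?case using \<delta>(2) by simp
    qed
  qed simp
  then have d: "(\<lambda>n. \<integral>\<^sup>+\<omega>. ennreal \<bar>?d n \<omega>\<bar> \<partial>M) \<longlonglongrightarrow> 0"
    by (intro Lp_tendsto_imp_L1_tendsto[OF p]) auto
  have "(\<lambda>n. \<integral>\<^sup>+\<omega>. ennreal \<bar>X n (grid_index n t) \<omega> - limit_process t \<omega>\<bar> \<partial>M) \<longlonglongrightarrow> 0"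
    using limit_process_L1[OF t] unfolding bridge_process_eq[OF t] .
  then have g: "(\<lambda>n. \<integral>\<^sup>+\<omega>. ennreal \<bar>limit_process t \<omega> - X n (grid_index n t) \<omega>\<bar> \<partial>M) \<longlonglongrightarrow> 0"
    by (simp add: abs_minus_commute)
  have l: "(\<lambda>n. (\<integral>\<^sup>+\<omega>. ennreal \<bar>?d n \<omega>\<bar> \<partial>M) + (\<integral>\<^sup>+\<omega>. ennreal \<bar>limit_process t \<omega> - X n (grid_index n t) \<omega>\<bar> \<partial>M)) \<longlonglongrightarrow> 0"
    using tendsto_add[OF d g] by simp
  have "(\<integral>\<^sup>+\<omega>. ennreal \<bar>X n (upper_index n t) \<omega> - limit_process t \<omega>\<bar> \<partial>M) \<le>
      (\<integral>\<^sup>+\<omega>. ennreal \<bar>?d n \<omega>\<bar> \<partial>M) + (\<integral>\<^sup>+\<omega>. ennreal \<bar>limit_process t \<omega> - X n (grid_index n t) \<omega>\<bar> \<partial>M)" for n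
    by (subst nn_integral_add[symmetric])
       (auto intro!: nn_integral_mono ennreal_leI simp flip: ennreal_plus)
  then show ?thesis
    by (intro tendsto_sandwich[OF _ _ tendsto_const l]) auto
qed

text \<open>Opposite roundings are used. For adaptedness t is rounded down, so that the grid value
  is known at time t. For independence both times are rounded up, so that the grid increment starts
  no earlier than s.\<close>

lemma levy_filtration_limit_process:
  fixes F :: "real \<Rightarrow> 'a measure"
  assumes F: "\<And>t. 0 \<le> t \<Longrightarrow> subalgebra M (F t)" "\<And>s t. 0 \<le> s \<Longrightarrow> s \<le> t \<Longrightarrow> sets (F s) \<subseteq> sets (F t)"
    and filt: "\<And>n. levy_filtration M F (dyadic_grid T n) (bridge_process T X n)"
  shows "levy_filtration M F {0..T} limit_process"
proof -
  have grid_mem: "real j * T / 2 ^ n \<in> dyadic_grid T n" if "j \<le> 2 ^ n" for j n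
    using that unfolding dyadic_grid_def by blast
  have grid_T: "real j * T / 2 ^ n \<in> {0..T}" if "j \<le> 2 ^ n" for j n
  proof -
    have "real j \<le> real (2 ^ n)" using that by (rule of_nat_mono)
    then show ?thesis using T by (simp add: field_simps)
  qed
  have grid_val: "bridge_process T X n (real j * T / 2 ^ n) = X n j" if "j \<le> 2 ^ n" for j n
    using bridge_process_eq[OF grid_T[OF that]] by (simp only: grid_index_grid)
  show ?thesis
    unfolding levy_filtration_def
  proof (intro conjI ballI impI)
    fix t assume t: "t \<in> {0..T}"
    have "bridge_process T X n t \<in> borel_measurable (F t)" for n
    proof -
      let ?k = "grid_index n t"
      have k: "?k \<le> 2 ^ n" using t by (intro grid_index_bound) auto
      have le: "real ?k * T / 2 ^ n \<le> t" using t by (intro grid_index_le) auto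
      have "subalgebra (F t) (F (real ?k * T / 2 ^ n))"
        using F(1)[of t] F(1)[of "real ?k * T / 2 ^ n"] F(2)[OF _ le] t grid_T[OF k]
        by (auto simp: subalgebra_def)
      moreover have "bridge_process T X n (real ?k * T / 2 ^ n) \<in> borel_measurable (F (real ?k * T / 2 ^ n))"
        using filt[of n] grid_mem[OF k] unfolding levy_filtration_def by blast
      ultimately show ?thesis
        unfolding grid_val[OF k] bridge_process_eq[OF t] by (rule measurable_from_subalg)
    qed
    then show "limit_process t \<in> borel_measurable (F t)"
      unfolding limit_process_def[abs_def] by (intro borel_measurable_lim_metric)
  next
    fix s t assume st: "s \<in> {0..T}" "t \<in> {0..T}" "s \<le> t"
    note [measurable] = limit_process_measurable[OF st(1)] limit_process_measurable[OF st(2)]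
    let ?L = "\<lambda>\<omega>. limit_process t \<omega> - limit_process s \<omega>"
    have Fs: "sets (F s) \<subseteq> events" using F(1)[of s] st by (auto simp: subalgebra_def)
    have "prob (A \<inter> (?L -` B \<inter> space M)) = prob A * prob (?L -` B \<inter> space M)"
      if A: "A \<in> sets (F s)" and B: "B \<in> sets borel" for A B
    proof -
      have AM [measurable]: "A \<in> events" using A Fs by auto
      let ?Z = "\<lambda>n \<omega>. X n (upper_index n t) \<omega> - X n (upper_index n s) \<omega>"
      note [measurable] = X_measurable[OF upper_index_bound]
      \<comment> \<open>Replacing the event A by its indicator, a sequence constant in n, turns
        independence of an event and an increment into that of two variables, to which
        \<open>indep_vars_L1_limit\<close> applies. The event returns as the set where the indicator
        is 1.\<close>
      have "indep_vars (\<lambda>_. borel) (case_bool (indicat_real A) ?L) UNIV"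
      proof (rule indep_vars_L1_limit[where Z = "\<lambda>n. case_bool (indicat_real A) (?Z n)"])
        fix n
        let ?s = "real (upper_index n s) * T / 2 ^ n" and ?t = "real (upper_index n t) * T / 2 ^ n"
        have "?s \<le> ?t"
          using T upper_index_mono[OF st(3), of n] by (intro divide_right_mono mult_right_mono) auto
        then have "indep_set (sets (F ?s)) {(\<lambda>\<omega>. bridge_process T X n ?t \<omega> - bridge_process T X n ?s \<omega>) -` B \<inter> space M | B. B \<in> sets borel}"
          using filt[of n] grid_mem[OF upper_index_bound] unfolding levy_filtration_def by blast
        then have ind: "indep_sets (case_bool (sets (F ?s)) {?Z n -` B \<inter> space M | B. B \<in> sets borel}) UNIV"
          unfolding grid_val[OF upper_index_bound] indep_set_def .
        \<comment> \<open>Here the upward rounding enters: A belongs to \<open>F s\<close>, hence to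
          the larger algebra at the grid time \<open>?s\<close>, of which the grid increments from
          \<open>?s\<close> on are independent.\<close>
        have A': "A \<in> sets (F ?s)"
          using A F(2)[of s ?s] upper_index_ge[OF st(1), of n] st by auto
        have sp: "space (F ?s) = space M"
          using F(1)[of ?s] grid_T[OF upper_index_bound] by (auto simp: subalgebra_def)
        have "indicat_real A \<in> borel_measurable (F ?s)"
          using A' by simp
        then have "indicat_real A -` C \<inter> space M \<in> sets (F ?s)" if "C \<in> sets borel" for C
          using measurable_sets[of "indicat_real A" "F ?s" borel C] that sp by simp
        then have "indep_sets (\<lambda>i. {case_bool (indicat_real A) (?Z n) i -` C \<inter> space M | C. C \<in> sets borel}) UNIV"
          by (intro indep_sets_mono_sets[OF ind]) (auto split: bool.splits)
        then show "indep_vars (\<lambda>_. borel) (case_bool (indicat_real A) (?Z n)) UNIV"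
          unfolding indep_vars_def2 by (auto split: bool.splits)
      next
        fix i :: bool
        show "case_bool (indicat_real A) ?L i \<in> borel_measurable M" by (cases i) auto
        show "(\<lambda>n. \<integral>\<^sup>+\<omega>. ennreal \<bar>case_bool (indicat_real A) (?Z n) i \<omega> - case_bool (indicat_real A) ?L i \<omega>\<bar> \<partial>M) \<longlonglongrightarrow> 0"
        proof (cases i)
          case False
          have "(\<lambda>n. \<integral>\<^sup>+\<omega>. ennreal \<bar>?Z n \<omega> - ?L \<omega>\<bar> \<partial>M) \<longlonglongrightarrow> 0"
            using st by (intro L1_tendsto_diff upper_index_L1) auto
          then show ?thesis using False by simp
        qed simp
      qed simp
      from indep_varsD_finite[OF this, of "case_bool {1} B"]
      have "prob ((indicat_real A -` {1} \<inter> space M) \<inter> (?L -` B \<inter> space M)) =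
          prob (indicat_real A -` {1} \<inter> space M) * prob (?L -` B \<inter> space M)"
        using B by (simp add: UNIV_bool Int_ac mult.commute split: bool.split)
      moreover have "indicat_real A -` {1} \<inter> space M = A"
        using sets.sets_into_space[OF AM] by (auto simp: indicator_def split: if_splits)
      ultimately show ?thesis by simp
    qed
    then show "indep_set (sets (F s)) {?L -` B \<inter> space M | B. B \<in> sets borel}"
      using Fs by (intro indep_setI) auto
  qed
qed

end

theorem theorem3p2:
  fixes M :: "'a measure" and F :: "real \<Rightarrow> 'a measure"
    and T p :: real
    and \<mu> :: "real measure" and \<phi> :: "real \<Rightarrow> complex"
    and f :: "real \<Rightarrow> real \<Rightarrow> real"
    and X :: "nat \<Rightarrow> nat \<Rightarrow> 'a \<Rightarrow> real"
  assumes "T > 0"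
    and "usual_filtered_prob_space M F"
    and "infinitely_divisible \<mu>" and "\<phi> = char \<mu>"
    and "\<And>t. t \<in> {0<..T} \<union> {1} \<Longrightarrow> prob_density_of_char (f t) (char_power \<phi> t)"
    and "bridge_sampling M T f X"
    and "p \<ge> 1"
    and "integrable lborel (\<lambda>x. \<bar>x\<bar> powr p * f 1 x)"
  shows "\<exists>L. levy_process M T L \<and>
           (\<forall>t\<in>{0..T}. char (distr M borel (L t)) = char_power \<phi> t) \<and>
           ((\<forall>n. levy_filtration M F (dyadic_grid T n) (bridge_process T X n)) \<longrightarrow>
              levy_filtration M F {0..T} L) \<and>
           (\<forall>t\<in>{0..T}.
              (\<lambda>n. \<integral>\<^sup>+\<omega>. ennreal (\<bar>bridge_process T X n t \<omega> - L t \<omega>\<bar> powr p) \<partial>M) \<longlonglongrightarrow> 0)"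
proof -
  interpret F: usual_filtered_prob_space M F by fact
  have char_power: "char_power \<phi> t = (\<lambda>u. exp (of_real t * distinguished_log \<phi> u))" for t
    by (simp add: char_power_def fun_eq_iff)
  \<comment> \<open>The distinguished logarithm of \<phi> serves as the exponent, which puts
    \<open>char_power\<close> into the semigroup form of \<open>levy_densities\<close>.\<close>
  interpret bridge_setup "distinguished_log \<phi>" f T p M X
    using assms unfolding char_power by unfold_locales auto
  show ?thesis
  proof (intro exI[of _ limit_process] conjI ballI impI)
    show "char (distr M borel (limit_process t)) = char_power \<phi> t" if "t \<in> {0..T}" for t
      using char_limit_process[OF that] unfolding char_power .
    show "levy_filtration M F {0..T} limit_process"
      if "\<forall>n. levy_filtration M F (dyadic_grid T n) (bridge_process T X n)"
      using that by (intro levy_filtration_limit_process F.subalg F.mono) auto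
  qed (auto intro: levy_process_limit_process limit_process_Lp)
qed

end
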